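(* Let $\varphi_t$ be a quadratic generic flow in $\mathbf{Bir}^3$. Then $\varphi_t$ is determined by a linear flow $\eta_t$ on the $\mathbb P^2$ of the net of lines through $P_I$ and a linear flow $\chi_t$ on the $\mathbb P^1$ of the pencil of planes through the line $C_I$. Namely, for $P\in\mathbb P^3$, $$\varphi_t(P)=\eta_t(P\vee P_I) \cap \chi_t(P\vee C_I).$$
   Context: We work over $\mathbb C$; $\mathbf{Bir}^3$ is the group of birational maps of the complex projective space $\mathbb P^3$, and $A_1$ is the space of linear forms on $\mathbb C^4$. $\mathrm{lin}$ is the set of quadruples of quadratic forms $(\ell\ell_0,\ell\ell_1,\ell\ell_2,\ell\ell_3)$ with $\ell\in A_1\setminus\{0\}$ and $\ell_0,\dots,\ell_3\in A_1$ linearly independent (linear automorphisms written in degree 2). $\mathbf{Bir}^3_{2,2}$ is the union of $\mathrm{lin}$ and the set of birational maps of $\mathbb P^3$ of degree 2 whose inverse is also of degree 2. For $\varphi\in\mathbf{Bir}^3_{2,2}\setminus\mathrm{lin}$ the indeterminacy locus is $C_I$ or $C_I\cup\{P_I\}$, where $C_I$ is a plane conic and $P_I$ is the unique point blown up by $\varphi$ to a plane; $\varphi$ is generic if $P_I\notin C_I$. A (germ of) flow in $\mathbf{Bir}^3$ is a germ at $0\in\mathbb C$ of holomorphic map $t\mapsto\varphi_t\in\mathbf{Bir}^3$ with $\varphi_{t+s}=\varphi_t\circ\varphi_s$ and $\varphi_0=\mathrm{id}$. It is quadratic if $\varphi_t\in\mathbf{Bir}^3_{2,2}$ and $\varphi_t\notin\mathrm{lin}$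 for generic $t$; it is a quadratic generic flow if moreover each $\varphi_t\notin\mathrm{lin}$ is generic. For a quadratic generic flow it is known that $P_I$ and $C_I$ do not depend on $t$ and that $C_I$ is a conic of rank 1, i.e. a double line, which is identified with its supporting line. $P\vee P_I$ and $P\vee C_I$ denote the line, resp. plane, spanned. A linear flow on $\mathbb P^n$ is a flow $t\mapsto \eta_t\in\mathrm{PGL}_{n+1}(\mathbb C)$.
   Formalization: That P_I and C_I are independent of t and C_I is a double line is assumed: it fails for some quadratic generic flows (e.g. special conformal flows). P lies off P_I and C_I; where φ_t is linear (t=0) and P is in the plane P_I∨C_I, only φ_t(P) ∈ the intersection is claimed. *)

theory Defs
  imports "HOL-Analysis.Analysis"
begin

section \<open>Forms and rational maps of projective 3-space\<close>

text \<open>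
  Points of P^3 are given by nonzero vectors of \<open>complex ^ 4\<close>, linear subspaces of P^3 by complex
  linear subspaces of \<open>complex ^ 4\<close> (sets of vectors, including 0).  Forms are polynomial functions.
\<close>

definition form_of :: "nat \<Rightarrow> ((4 \<Rightarrow> nat) \<Rightarrow> complex) \<Rightarrow> complex ^ 4 \<Rightarrow> complex" where
  "form_of d c x = (\<Sum>\<alpha> | (\<Sum>i\<in>UNIV. \<alpha> i) = d. c \<alpha> * (\<Prod>i\<in>UNIV. (x $ i) ^ \<alpha> i))"

definition form :: "nat \<Rightarrow> (complex ^ 4 \<Rightarrow> complex) \<Rightarrow> bool" where
  "form d f \<longleftrightarrow> (\<exists>c. f = form_of d c)"

definition forms :: "nat \<Rightarrow> (complex ^ 4 \<Rightarrow> complex ^ 4) \<Rightarrow> bool" where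
  "forms d F \<longleftrightarrow> (\<forall>i. form d (\<lambda>x. F x $ i))"

definition A1 :: "(complex ^ 4 \<Rightarrow> complex) set" where
  "A1 = {l. form 1 l}"

text \<open>A rational map is represented by any nonzero quadruple of forms of the same degree; two
  quadruples represent the same rational map iff they are proportional over the function field.\<close>

definition ratmap :: "(complex ^ 4 \<Rightarrow> complex ^ 4) \<Rightarrow> bool" where
  "ratmap F \<longleftrightarrow> (\<exists>d. forms d F) \<and> (\<exists>x. F x \<noteq> 0)"

definition same_map :: "(complex ^ 4 \<Rightarrow> complex ^ 4) \<Rightarrow> (complex ^ 4 \<Rightarrow> complex ^ 4) \<Rightarrow> bool" where
  "same_map F G \<longleftrightarrow> (\<exists>x. F x \<noteq> 0) \<and> (\<exists>x. G x \<noteq> 0) \<and>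
     (\<forall>x i j. F x $ i * G x $ j = F x $ j * G x $ i)"

definition inverse_maps :: "(complex ^ 4 \<Rightarrow> complex ^ 4) \<Rightarrow> (complex ^ 4 \<Rightarrow> complex ^ 4) \<Rightarrow> bool" where
  "inverse_maps F G \<longleftrightarrow> ratmap F \<and> ratmap G \<and> same_map (F \<circ> G) id \<and> same_map (G \<circ> F) id"

definition birational :: "(complex ^ 4 \<Rightarrow> complex ^ 4) \<Rightarrow> bool" where
  "birational F \<longleftrightarrow> (\<exists>G. inverse_maps F G)"

definition no_common_factor :: "nat \<Rightarrow> (complex ^ 4 \<Rightarrow> complex ^ 4) \<Rightarrow> bool" where
  "no_common_factor d F \<longleftrightarrow>
     \<not> (\<exists>k h H. 0 < k \<and> k \<le> d \<and> form k h \<and> forms (d - k) H \<and> F = (\<lambda>x. h x *s H x))"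

definition reduced_rep :: "nat \<Rightarrow> (complex ^ 4 \<Rightarrow> complex ^ 4) \<Rightarrow> (complex ^ 4 \<Rightarrow> complex ^ 4) \<Rightarrow> bool" where
  "reduced_rep d F Q \<longleftrightarrow> forms d Q \<and> no_common_factor d Q \<and> same_map F Q"

definition has_degree :: "(complex ^ 4 \<Rightarrow> complex ^ 4) \<Rightarrow> nat \<Rightarrow> bool" where
  "has_degree F d \<longleftrightarrow> (\<exists>Q. reduced_rep d F Q)"

text \<open>\<open>image_at F x y\<close>: the rational map is defined at the point \<open>x\<close>, with value the point \<open>y\<close>
  (some representative does not vanish there).\<close>

definition image_at :: "(complex ^ 4 \<Rightarrow> complex ^ 4) \<Rightarrow> complex ^ 4 \<Rightarrow> complex ^ 4 \<Rightarrow> bool" where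
  "image_at F x y \<longleftrightarrow> x \<noteq> 0 \<and> y \<noteq> 0 \<and> (\<exists>d G. forms d G \<and> same_map F G \<and> G x = y)"

definition indeterminacy :: "(complex ^ 4 \<Rightarrow> complex ^ 4) \<Rightarrow> (complex ^ 4) set" where
  "indeterminacy F = {x. x \<noteq> 0 \<and> \<not> (\<exists>y. image_at F x y)}"

section \<open>Maps of bidegree (2,2), the conic and the point P_I\<close>

definition lin :: "(complex ^ 4 \<Rightarrow> complex ^ 4) set" where
  "lin = {F. \<exists>l ls. l \<in> A1 \<and> l \<noteq> (\<lambda>_. 0) \<and> (\<forall>i. ls i \<in> A1) \<and>
       (\<forall>a :: 4 \<Rightarrow> complex. (\<forall>x. (\<Sum>i\<in>UNIV. a i * ls i x) = 0) \<longrightarrow> (\<forall>i. a i = 0)) \<and>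
       F = (\<lambda>x. \<chi> i. l x * ls i x)}"

definition is_lin :: "(complex ^ 4 \<Rightarrow> complex ^ 4) \<Rightarrow> bool" where
  "is_lin F \<longleftrightarrow> (\<exists>L\<in>lin. same_map F L)"

definition bir22 :: "(complex ^ 4 \<Rightarrow> complex ^ 4) \<Rightarrow> bool" where
  "bir22 F \<longleftrightarrow> is_lin F \<or> (has_degree F 2 \<and> (\<exists>G. inverse_maps F G \<and> has_degree G 2))"

text \<open>The total transform of a point: the fibre over \<open>p\<close> of the closure of the graph (written on
  affine cones; the Euclidean closure of the graph equals its Zariski closure).\<close>

definition total_transform :: "(complex ^ 4 \<Rightarrow> complex ^ 4) \<Rightarrow> complex ^ 4 \<Rightarrow> (complex ^ 4) set" where
  "total_transform F p = {y. y \<noteq> 0 \<and> (p, y) \<in> closure {(x, c *s F x) |x c. F x \<noteq> 0}}"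

definition blown_up_to_plane :: "(complex ^ 4 \<Rightarrow> complex ^ 4) \<Rightarrow> complex ^ 4 \<Rightarrow> bool" where
  "blown_up_to_plane F p \<longleftrightarrow> p \<noteq> 0 \<and>
     (\<exists>h\<in>A1. h \<noteq> (\<lambda>_. 0) \<and> total_transform F p = {y. y \<noteq> 0 \<and> h y = 0})"

definition is_PI :: "(complex ^ 4 \<Rightarrow> complex ^ 4) \<Rightarrow> complex ^ 4 \<Rightarrow> bool" where
  "is_PI F p \<longleftrightarrow> p \<noteq> 0 \<and> {x. blown_up_to_plane F x} = vec.span {p} - {0}"

text \<open>A plane conic is the scheme \<open>l = q = 0\<close>, so \<open>q\<close> only matters modulo \<open>l\<close>.\<close>

definition plane_conic :: "(complex ^ 4 \<Rightarrow> complex) \<Rightarrow> (complex ^ 4 \<Rightarrow> complex) \<Rightarrow> bool" where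
  "plane_conic l q \<longleftrightarrow> l \<in> A1 \<and> l \<noteq> (\<lambda>_. 0) \<and> form 2 q \<and> (\<exists>x. l x = 0 \<and> q x \<noteq> 0)"

definition conic_points :: "(complex ^ 4 \<Rightarrow> complex) \<Rightarrow> (complex ^ 4 \<Rightarrow> complex) \<Rightarrow> (complex ^ 4) set" where
  "conic_points l q = {x. x \<noteq> 0 \<and> l x = 0 \<and> q x = 0}"

text \<open>The conic of indeterminacy.  The base scheme contains the conic, i.e. the quadrics of the map
  lie in the ideal \<open>(l, q)\<close>; set-theoretically the locus is the conic together with P_I (which may
  lie on the conic).  The ideal condition is what gives a double line its planar scheme structure.\<close>

definition is_CI :: "(complex ^ 4 \<Rightarrow> complex ^ 4) \<Rightarrow> (complex ^ 4 \<Rightarrow> complex) \<Rightarrow> (complex ^ 4 \<Rightarrow> complex) \<Rightarrow> bool" where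
  "is_CI F l q \<longleftrightarrow> plane_conic l q \<and>
     (\<exists>Q. reduced_rep 2 F Q \<and> (\<forall>i. \<exists>m\<in>A1. \<exists>c. \<forall>x. Q x $ i = l x * m x + c * q x)) \<and>
     (\<exists>p. is_PI F p \<and> indeterminacy F = conic_points l q \<union> (vec.span {p} - {0}))"

definition generic22 :: "(complex ^ 4 \<Rightarrow> complex ^ 4) \<Rightarrow> bool" where
  "generic22 F \<longleftrightarrow> bir22 F \<and> \<not> is_lin F \<and> (\<exists>p l q. is_PI F p \<and> is_CI F l q \<and> p \<notin> conic_points l q)"

text \<open>The conic has rank 1 (the form \<open>q\<close> restricted to the plane \<open>l = 0\<close> is the square of a linear
  form) and \<open>C\<close> is its supporting line.\<close>

definition double_line :: "(complex ^ 4 \<Rightarrow> complex) \<Rightarrow> (complex ^ 4 \<Rightarrow> complex) \<Rightarrow> (complex ^ 4) set \<Rightarrow> bool" where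
  "double_line l q C \<longleftrightarrow> plane_conic l q \<and>
     (\<exists>m\<in>A1. (\<forall>x. l x = 0 \<longrightarrow> q x = (m x)\<^sup>2) \<and> C = {x. l x = 0 \<and> m x = 0})"

section \<open>Germs of flows\<close>

text \<open>Holomorphic dependence of a family of quadruples of forms means holomorphic coefficients; a
  family of birational maps is holomorphic if it lifts to such a family of some degree.  The lift
  need not be reduced, so the degree of the maps may drop at special parameters.\<close>

definition holomorphic_forms :: "nat \<Rightarrow> complex set \<Rightarrow> (complex \<Rightarrow> complex ^ 4 \<Rightarrow> complex ^ 4) \<Rightarrow> bool" where
  "holomorphic_forms d U F \<longleftrightarrow>
     (\<exists>c :: complex \<Rightarrow> 4 \<Rightarrow> (4 \<Rightarrow> nat) \<Rightarrow> complex.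
        (\<forall>i \<alpha>. (\<lambda>t. c t i \<alpha>) holomorphic_on U) \<and>
        (\<forall>t\<in>U. \<forall>x i. F t x $ i = form_of d (c t i) x))"

definition flow_germ :: "(complex \<Rightarrow> complex ^ 4 \<Rightarrow> complex ^ 4) \<Rightarrow> bool" where
  "flow_germ \<phi> \<longleftrightarrow>
     (\<exists>r>0. (\<forall>t\<in>ball 0 r. birational (\<phi> t)) \<and>
        (\<exists>d F. holomorphic_forms d (ball 0 r) F \<and> (\<forall>t\<in>ball 0 r. same_map (\<phi> t) (F t))) \<and>
        same_map (\<phi> 0) id \<and>
        (\<forall>s\<in>ball 0 r. \<forall>t\<in>ball 0 r. t + s \<in> ball 0 r \<longrightarrow> same_map (\<phi> (t + s)) (\<phi> t \<circ> \<phi> s)))"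

text \<open>For a germ at 0, generic \<open>t\<close> means all \<open>t\<close> in a punctured neighbourhood of 0.\<close>

definition quadratic_flow :: "(complex \<Rightarrow> complex ^ 4 \<Rightarrow> complex ^ 4) \<Rightarrow> bool" where
  "quadratic_flow \<phi> \<longleftrightarrow> flow_germ \<phi> \<and>
     (\<forall>\<^sub>F t in nhds 0. bir22 (\<phi> t)) \<and> (\<forall>\<^sub>F t in at 0. \<not> is_lin (\<phi> t))"

definition quadratic_generic_flow :: "(complex \<Rightarrow> complex ^ 4 \<Rightarrow> complex ^ 4) \<Rightarrow> bool" where
  "quadratic_generic_flow \<phi> \<longleftrightarrow> quadratic_flow \<phi> \<and>
     (\<forall>\<^sub>F t in nhds 0. \<not> is_lin (\<phi> t) \<longrightarrow> generic22 (\<phi> t))"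

definition flow_PI :: "(complex \<Rightarrow> complex ^ 4 \<Rightarrow> complex ^ 4) \<Rightarrow> complex ^ 4 \<Rightarrow> bool" where
  "flow_PI \<phi> p \<longleftrightarrow> (\<forall>\<^sub>F t in nhds 0. \<not> is_lin (\<phi> t) \<longrightarrow> is_PI (\<phi> t) p)"

text \<open>Only the supporting line is constant: the plane in which the line is doubled moves with \<open>t\<close>.\<close>

definition flow_CI :: "(complex \<Rightarrow> complex ^ 4 \<Rightarrow> complex ^ 4) \<Rightarrow> (complex ^ 4) set \<Rightarrow> bool" where
  "flow_CI \<phi> C \<longleftrightarrow>
     (\<forall>\<^sub>F t in nhds 0. \<not> is_lin (\<phi> t) \<longrightarrow> (\<exists>l q. is_CI (\<phi> t) l q \<and> double_line l q C))"

text \<open>A linear flow on a projective space, given by a holomorphic lift to invertible matrices.\<close>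

definition same_projectivity :: "complex ^ 'n ^ 'n \<Rightarrow> complex ^ 'n ^ 'n \<Rightarrow> bool" where
  "same_projectivity M N \<longleftrightarrow> (\<exists>c. c \<noteq> 0 \<and> (\<forall>i j. M $ i $ j = c * N $ i $ j))"

definition linear_flow :: "(complex \<Rightarrow> complex ^ 'n ^ 'n) \<Rightarrow> bool" where
  "linear_flow M \<longleftrightarrow>
     (\<exists>r>0. (\<forall>i j. (\<lambda>t. M t $ i $ j) holomorphic_on ball 0 r) \<and>
        (\<forall>t\<in>ball 0 r. invertible (M t)) \<and>
        same_projectivity (M 0) (mat 1) \<and>
        (\<forall>s\<in>ball 0 r. \<forall>t\<in>ball 0 r. t + s \<in> ball 0 r \<longrightarrow>
            same_projectivity (M (t + s)) (M t ** M s)))"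

section \<open>Spans, and projectivities acting on lines through a point or planes through a line\<close>

definition join :: "(complex ^ 4) set \<Rightarrow> (complex ^ 4) set \<Rightarrow> (complex ^ 4) set" (infixl \<open>\<or>\<^sub>P\<close> 65) where
  "S \<or>\<^sub>P T = vec.span (S \<union> T)"

text \<open>
  If \<open>A\<close> has kernel \<open>K\<close> (and is onto), then \<open>S \<mapsto> A(S)\<close> identifies the subspaces of dimension
  \<open>dim K + 1\<close> containing \<open>K\<close> with the points of the projective space with homogeneous coordinates
  in \<open>complex ^ 'n\<close>: the net of lines through a point for \<open>'n = 3\<close>, the pencil of planes through a
  line for \<open>'n = 2\<close>.  \<open>proj_act A M\<close> is the action of the projectivity \<open>M\<close> on such subspaces.
\<close>

definition proj_act :: "complex ^ 4 ^ 'n \<Rightarrow> complex ^ 'n ^ 'n \<Rightarrow> (complex ^ 4) set \<Rightarrow> (complex ^ 4) set" where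
  "proj_act A M S = {x. A *v x \<in> (\<lambda>y. M *v (A *v y)) ` S}"

end

theory Submission
  imports Defs "HOL-Computational_Algebra.Polynomial"
begin

text \<open>
  Write \<open>p\<close> for \<open>P\<^sub>I\<close> and \<open>u\<close> for an equation of the plane spanned by \<open>p\<close> and the line \<open>C\<close>.
  Completing the square, the quadrics of a generic map whose conic is the double line on \<open>C\<close> take
  the form \<open>Q x = l x \<cdot> T x + (u x)\<^sup>2 \<cdot> c\<close> with \<open>l\<close> vanishing on \<open>C\<close>, \<open>l p \<noteq> 0\<close>, \<open>T\<close> linear and
  \<open>T p = 0\<close>.  Since \<open>\<phi>\<^bsub>-t\<^esub>\<close> inverts \<open>\<phi>\<^bsub>t\<^esub>\<close> and has the same \<open>p\<close> and \<open>C\<close>, the points onto which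
  \<open>\<phi>\<^bsub>t\<^esub>\<close> contracts the planes \<open>l = 0\<close> and \<open>u = 0\<close> lie in \<open>C \<union> {p}\<close>, and this forces \<open>c\<close> to be a
  multiple of \<open>p\<close> and \<open>T C = C\<close>.  Modulo \<open>p\<close> the map is then \<open>l \<cdot> T\<close>, and modulo \<open>C\<close> it is \<open>u\<close> times a
  linear map of \<open>(l, u)\<close>; these are the two projectivities.  They are determined by the images of a
  projective frame, hence can be lifted holomorphically up to and including \<open>t = 0\<close>.
\<close>

text \<open>The obstacle is regularity. \<open>flow_CI\<close> supplies \<open>l\<close> and
  \<open>q\<close> for each parameter separately, so the normal form, and with it the pair of
  projectivities, depends on t in no controlled way, and at t = 0 it does not exist. Holomorphy can
  only come from the lift in \<open>flow_germ\<close>, which need not be reduced: at t = 0 it may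
  vanish on a hypersurface. Maps are therefore compared by proportionality of values
  (\<open>par\<close>), which tolerates zeros and extends from the nonvanishing locus of a
  polynomial, and the frame is chosen off the zeros of the lift at 0. A contracted point is a base
  point of the inverse for this reason: if \<open>Q\<close> takes proportional values at two
  nonproportional points, then \<open>Q'\<close> at such a value is proportional to both points,
  hence zero.\<close>

section \<open>Polynomial functions\<close>

text \<open>Composites and products of forms of various degrees occur. What matters is that they
  restrict to one-variable polynomials on lines; closure under ring operations avoids tracking
  degrees.\<close>

inductive polyfun :: "(complex ^ 'n \<Rightarrow> complex) \<Rightarrow> bool" where
  const: "polyfun (\<lambda>_. c)"
| coord: "polyfun (\<lambda>x. x $ i)"
| add: "polyfun f \<Longrightarrow> polyfun g \<Longrightarrow> polyfun (\<lambda>x. f x + g x)"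
| mult: "polyfun f \<Longrightarrow> polyfun g \<Longrightarrow> polyfun (\<lambda>x. f x * g x)"

lemma polyfun_diff: "polyfun f \<Longrightarrow> polyfun g \<Longrightarrow> polyfun (\<lambda>x. f x - g x)"
  using polyfun.add[OF _ polyfun.mult[OF polyfun.const[of "-1"]], of f g] by simp

lemma polyfun_sum: "(\<And>a. a \<in> S \<Longrightarrow> polyfun (f a)) \<Longrightarrow> polyfun (\<lambda>x. \<Sum>a\<in>S. f a x)"
  by (induction S rule: infinite_finite_induct) (auto intro: polyfun.intros)

lemma polyfun_prod: "(\<And>a. a \<in> S \<Longrightarrow> polyfun (f a)) \<Longrightarrow> polyfun (\<lambda>x. \<Prod>a\<in>S. f a x)"
  by (induction S rule: infinite_finite_induct) (auto intro: polyfun.intros)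

lemma polyfun_power: "polyfun f \<Longrightarrow> polyfun (\<lambda>x. f x ^ k)"
  by (induction k) (auto intro: polyfun.intros)

lemma polyfun_compose:
  assumes "polyfun f" and "\<And>i. polyfun (\<lambda>x. G x $ i)"
  shows "polyfun (\<lambda>x. f (G x))"
  using assms by (induction rule: polyfun.induct) (auto intro: polyfun.intros)

lemma polyfun_matrix:
  assumes "\<And>i. polyfun (\<lambda>x. G x $ i)"
  shows "polyfun (\<lambda>x. (K *v G x) $ j)"
  unfolding matrix_vector_mult_def
  by (simp, intro polyfun_sum polyfun.mult polyfun.const assms)

lemma polyfun_form: "form d f \<Longrightarrow> polyfun f"
  unfolding form_def form_of_def
  by (elim exE, hypsubst) (intro polyfun_sum polyfun.mult[OF polyfun.const] polyfun_prod polyfun_power polyfun.coord)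

lemma polyfun_forms: "forms d F \<Longrightarrow> polyfun (\<lambda>x. F x $ i)"
  unfolding forms_def by (blast intro: polyfun_form)

lemma polyfun_along_line:
  assumes "polyfun f"
  shows "\<exists>p. \<forall>t. f (x + t *s y) = poly p t"
  using assms
proof induction
  case (const c)
  show ?case by (intro exI[of _ "[:c:]"]) simp
next
  case (coord i)
  show ?case by (intro exI[of _ "[:x $ i, y $ i:]"]) simp
next
  case (add f g)
  then obtain p q where "\<forall>t. f (x + t *s y) = poly p t" "\<forall>t. g (x + t *s y) = poly q t" by blast
  then show ?case by (intro exI[of _ "p + q"]) simp
next
  case (mult f g)
  then obtain p q where "\<forall>t. f (x + t *s y) = poly p t" "\<forall>t. g (x + t *s y) = poly q t" by blast
  then show ?case by (intro exI[of _ "p * q"]) simp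
qed

lemma polyfun_eventually_nonzero_on_line:
  assumes "polyfun f" and "f x \<noteq> 0"
  shows "\<forall>\<^sub>F e in at 0. f (x + e *s y) \<noteq> 0"
proof -
  obtain p where p: "\<forall>t. f (x + t *s y) = poly p t"
    using polyfun_along_line[OF assms(1)] by blast
  have "poly p 0 \<noteq> 0"
    using p[rule_format, of 0] assms(2) by simp
  moreover have "(poly p \<longlongrightarrow> poly p 0) (at 0)"
    by (rule isContD) (rule poly_isCont)
  ultimately have "\<forall>\<^sub>F e in at 0. poly p e \<noteq> 0"
    by (intro tendsto_imp_eventually_ne)
  then show ?thesis
    using p by simp
qed

text \<open>On the line through \<open>x\<close> and \<open>y\<close> both functions become nonzero
  polynomials in one variable, whose product is nonzero. This stands in for the irreducibility of
  affine space.\<close>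

lemma polyfun_mult_nonzero:
  assumes "polyfun f" "polyfun g" "f x \<noteq> 0" "g y \<noteq> 0"
  shows "\<exists>z. f z \<noteq> 0 \<and> g z \<noteq> 0"
proof -
  obtain p q where p: "\<forall>t. f (x + t *s (y - x)) = poly p t" and q: "\<forall>t. g (x + t *s (y - x)) = poly q t"
    using polyfun_along_line[OF assms(1), of x "y - x"] polyfun_along_line[OF assms(2), of x "y - x"]
    by blast
  have "poly p 0 \<noteq> 0"
    using p[rule_format, of 0] assms(3) by simp
  moreover have "poly q 1 \<noteq> 0"
    using q[rule_format, of 1] assms(4) by simp
  ultimately have "p * q \<noteq> 0"
    by auto
  then obtain t where "poly (p * q) t \<noteq> 0"
    using poly_all_0_iff_0 by blast
  then show ?thesis
    using p q by (intro exI[of _ "x + t *s (y - x)"]) simp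
qed

lemma polyfun_zero_if_generically_zero:
  assumes "polyfun f" "polyfun g" "g y \<noteq> 0" "\<And>x. g x \<noteq> 0 \<Longrightarrow> f x = 0"
  shows "f x = 0"
  using polyfun_mult_nonzero[OF assms(1,2) _ assms(3)] assms(4) by blast

section \<open>Homogeneity, linear forms and quadratic forms\<close>

lemma form_homogeneous:
  assumes "form d f"
  shows "f (c *s x) = c ^ d * f x"
proof -
  have "(\<Prod>i\<in>UNIV. (c * x $ i) ^ \<alpha> i) = c ^ d * (\<Prod>i\<in>UNIV. (x $ i) ^ \<alpha> i)"
    if "(\<Sum>i\<in>UNIV. \<alpha> i) = d" for \<alpha> :: "4 \<Rightarrow> nat"
    using that by (auto simp: power_mult_distrib prod.distrib power_sum)
  then show ?thesis
    using assms unfolding form_def form_of_def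
    by (auto simp: sum_distrib_left algebra_simps intro!: sum.cong)
qed

lemma forms_homogeneous: "forms d F \<Longrightarrow> F (c *s x) = c ^ d *s F x"
  unfolding forms_def vec_eq_iff using form_homogeneous[of d "\<lambda>x. F x $ i" for i] by simp

text \<open>Peeling off variables turns monomials of degree 1 into coordinates and those of degree 2
  into products of two coordinates.\<close>

lemma monomial_split:
  fixes \<alpha> :: "4 \<Rightarrow> nat"
  assumes "(\<Sum>i\<in>UNIV. \<alpha> i) = Suc d"
  shows "\<exists>k \<beta>. (\<Sum>i\<in>UNIV. \<beta> i) = d \<and>
    (\<forall>x :: complex ^ 4. (\<Prod>i\<in>UNIV. (x $ i) ^ \<alpha> i) = x $ k * (\<Prod>i\<in>UNIV. (x $ i) ^ \<beta> i))"
proof -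
  obtain k where k: "\<alpha> k \<noteq> 0"
    using assms by (metis nat.distinct(1) sum.neutral)
  define \<beta> where "\<beta> = \<alpha>(k := \<alpha> k - 1)"
  have "(\<Sum>i\<in>UNIV. \<alpha> i) = \<alpha> k + (\<Sum>i\<in>UNIV - {k}. \<alpha> i)"
    by (simp add: sum.remove)
  moreover have "(\<Sum>i\<in>UNIV. \<beta> i) = \<beta> k + (\<Sum>i\<in>UNIV - {k}. \<beta> i)"
    by (simp add: sum.remove)
  moreover have "(\<Sum>i\<in>UNIV - {k}. \<beta> i) = (\<Sum>i\<in>UNIV - {k}. \<alpha> i)"
    by (rule sum.cong) (auto simp: \<beta>_def)
  ultimately have 1: "(\<Sum>i\<in>UNIV. \<beta> i) = d"
    using assms k by (simp add: \<beta>_def)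
  have "(\<Prod>i\<in>UNIV. (x $ i) ^ \<alpha> i) = x $ k * (\<Prod>i\<in>UNIV. (x $ i) ^ \<beta> i)" for x :: "complex ^ 4"
  proof -
    have "(\<Prod>i\<in>UNIV. (x $ i) ^ \<alpha> i) = (x $ k) ^ \<alpha> k * (\<Prod>i\<in>UNIV - {k}. (x $ i) ^ \<alpha> i)"
      by (simp add: prod.remove)
    moreover have "(\<Prod>i\<in>UNIV. (x $ i) ^ \<beta> i) = (x $ k) ^ \<beta> k * (\<Prod>i\<in>UNIV - {k}. (x $ i) ^ \<beta> i)"
      by (simp add: prod.remove)
    moreover have "(\<Prod>i\<in>UNIV - {k}. (x $ i) ^ \<beta> i) = (\<Prod>i\<in>UNIV - {k}. (x $ i) ^ \<alpha> i)"
      by (rule prod.cong) (auto simp: \<beta>_def)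
    moreover have "(x $ k) ^ \<alpha> k = x $ k * (x $ k) ^ \<beta> k"
      using k by (simp add: \<beta>_def power_eq_if)
    ultimately show ?thesis by simp
  qed
  with 1 show ?thesis by blast
qed

text \<open>Unlike \<open>A1\<close> this is available in every dimension; it also serves on the
  coordinate space of the pencil of planes.\<close>

definition linear_form :: "(complex ^ 'n \<Rightarrow> complex) \<Rightarrow> bool" where
  "linear_form l \<longleftrightarrow> (\<forall>x y. l (x + y) = l x + l y) \<and> (\<forall>c x. l (c *s x) = c * l x)"

lemma linear_form_simps:
  assumes "linear_form l"
  shows "l (x + y) = l x + l y" "l (c *s x) = c * l x" "l 0 = 0" "l (- x) = - l x" "l (x - y) = l x - l y"
proof -
  show add: "l (x + y) = l x + l y" and sc: "l (c *s x) = c * l x" for x y c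
    using assms unfolding linear_form_def by auto
  show "l 0 = 0"
    using sc[of 0 0] by simp
  show neg: "l (- x) = - l x" for x
    using sc[of "-1" x] by (simp flip: vector_sneg_minus1)
  show "l (x - y) = l x - l y"
    using add[of x "- y"] neg by simp
qed

lemma linear_form_lincomb:
  "linear_form f \<Longrightarrow> linear_form g \<Longrightarrow> linear_form (\<lambda>x. a * f x + b * g x)"
  unfolding linear_form_def by (simp add: algebra_simps)

lemma linear_form_matrix: "linear_form l \<Longrightarrow> linear_form (\<lambda>x. l (K *v x))"
  by (simp add: linear_form_def vec.add vec.scale)

lemma linear_form_expand:
  assumes "linear_form l"
  shows "l x = (\<Sum>j\<in>UNIV. l (axis j 1) * x $ j)"
proof -
  have "l (\<Sum>j\<in>S. x $ j *s axis j 1) = (\<Sum>j\<in>S. l (axis j 1) * x $ j)" if "finite S" for S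
    using that by induction (auto simp: linear_form_simps[OF assms])
  from this[of UNIV] show ?thesis
    by (simp add: basis_expansion)
qed

lemma A1_linear_form:
  assumes "l \<in> A1"
  shows "linear_form l"
proof -
  obtain c where l: "l = form_of 1 c"
    using assms unfolding A1_def form_def by blast
  have m: "\<exists>k. \<forall>x :: complex ^ 4. (\<Prod>i\<in>UNIV. (x $ i) ^ \<alpha> i) = x $ k"
    if "(\<Sum>i\<in>UNIV. \<alpha> i) = 1" for \<alpha> :: "4 \<Rightarrow> nat"
    using monomial_split[of \<alpha> 0] that by auto
  then have "\<forall>\<alpha> \<in> {\<alpha>. (\<Sum>i\<in>UNIV. \<alpha> i) = 1}. \<exists>k. \<forall>x :: complex ^ 4. (\<Prod>i\<in>UNIV. (x $ i) ^ \<alpha> i) = x $ k"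
    by simp
  from bchoice[OF this] obtain k where k:
    "\<forall>\<alpha> \<in> {\<alpha>. (\<Sum>i\<in>UNIV. \<alpha> i) = 1}. \<forall>x :: complex ^ 4. (\<Prod>i\<in>UNIV. (x $ i) ^ \<alpha> i) = x $ k \<alpha>"
    by blast
  have "l x = (\<Sum>\<alpha> | (\<Sum>i\<in>UNIV. \<alpha> i) = 1. c \<alpha> * x $ k \<alpha>)" for x
    unfolding l form_of_def using k by (intro sum.cong refl) simp
  then show ?thesis
    unfolding linear_form_def by (simp add: sum.distrib sum_distrib_left algebra_simps)
qed

text \<open>Each quadratic monomial is written as an ordered product of two coordinates, so
  \<open>b\<close> need not be symmetric.\<close>

lemma form_2_bilinear:
  assumes "form 2 q"
  obtains b where "\<And>x. linear_form (b x)" "\<And>y. linear_form (\<lambda>x. b x y)" "\<And>x. q x = b x x"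
proof -
  obtain c where q: "q = form_of 2 c"
    using assms unfolding form_def by blast
  have m: "\<exists>j k. \<forall>x :: complex ^ 4. (\<Prod>i\<in>UNIV. (x $ i) ^ \<alpha> i) = x $ j * x $ k"
    if a: "(\<Sum>i\<in>UNIV. \<alpha> i) = 2" for \<alpha> :: "4 \<Rightarrow> nat"
  proof -
    obtain j \<beta> where j: "(\<Sum>i\<in>UNIV. \<beta> i) = Suc 0"
      "\<forall>x :: complex ^ 4. (\<Prod>i\<in>UNIV. (x $ i) ^ \<alpha> i) = x $ j * (\<Prod>i\<in>UNIV. (x $ i) ^ \<beta> i)"
      using monomial_split[of \<alpha> 1] a by auto
    moreover obtain k where "\<forall>x :: complex ^ 4. (\<Prod>i\<in>UNIV. (x $ i) ^ \<beta> i) = x $ k"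
      using monomial_split[OF j(1)]
      by (metis (no_types, lifting) UNIV_I finite power_0 prod.neutral_const sum_eq_0_iff
          mult.right_neutral prod.cong)
    ultimately show ?thesis using j(2) by auto
  qed
  then have "\<forall>\<alpha> \<in> {\<alpha>. (\<Sum>i\<in>UNIV. \<alpha> i) = 2}. \<exists>jk. \<forall>x :: complex ^ 4.
      (\<Prod>i\<in>UNIV. (x $ i) ^ \<alpha> i) = x $ fst jk * x $ snd jk"
    by simp
  from bchoice[OF this] obtain jk where jk: "\<forall>\<alpha> \<in> {\<alpha>. (\<Sum>i\<in>UNIV. \<alpha> i) = 2}. \<forall>x :: complex ^ 4.
      (\<Prod>i\<in>UNIV. (x $ i) ^ \<alpha> i) = x $ fst (jk \<alpha>) * x $ snd (jk \<alpha>)"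
    by blast
  define b where "b x y = (\<Sum>\<alpha> | (\<Sum>i\<in>UNIV. \<alpha> i) = 2. c \<alpha> * (x $ fst (jk \<alpha>) * y $ snd (jk \<alpha>)))" for x y :: "complex ^ 4"
  show ?thesis
  proof
    show "linear_form (b x)" "linear_form (\<lambda>x. b x y)" for x y
      unfolding linear_form_def b_def by (simp_all add: sum.distrib sum_distrib_left algebra_simps)
    show "q x = b x x" for x
      unfolding q form_of_def b_def using jk by (intro sum.cong refl) simp
  qed
qed

lemma coord_in_A1: "(\<lambda>x. x $ i) \<in> A1"
proof -
  have single: "(\<Sum>j\<in>UNIV. if j = i then 1 else 0) = (1 :: nat)"
    by simp
  \<comment> \<open>Over an infinite set of exponents the sum in \<open>form_of\<close> would take
    its default value 0.\<close>
  have "finite {\<alpha> :: 4 \<Rightarrow> nat. (\<Sum>j\<in>UNIV. \<alpha> j) = 1}"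
  proof (rule finite_subset)
    show "{\<alpha> :: 4 \<Rightarrow> nat. (\<Sum>j\<in>UNIV. \<alpha> j) = 1} \<subseteq> {\<alpha>. \<forall>j. \<alpha> j \<in> {0..1}}"
    proof clarify
      fix \<alpha> :: "4 \<Rightarrow> nat" and j
      assume "(\<Sum>j\<in>UNIV. \<alpha> j) = 1"
      then show "\<alpha> j \<in> {0..1}"
        using member_le_sum[of j UNIV \<alpha>] by simp
    qed
    show "finite {\<alpha> :: 4 \<Rightarrow> nat. \<forall>j. \<alpha> j \<in> {0..1}}"
      using finite_PiE[of "UNIV :: 4 set" "\<lambda>_. {0..1 :: nat}"] by (simp add: PiE_def Pi_def)
  qed
  then have fin: "finite {\<alpha> :: 4 \<Rightarrow> nat. (\<Sum>j\<in>UNIV. \<alpha> j) = 1}" .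
  define \<delta> where "\<delta> = (\<lambda>j. if j = i then 1 else 0 :: nat)"
  have "form_of 1 (\<lambda>\<alpha>. if \<alpha> = \<delta> then 1 else 0) x = x $ i" for x
  proof -
    have "form_of 1 (\<lambda>\<alpha>. if \<alpha> = \<delta> then 1 else 0) x =
        (\<Sum>\<alpha> | (\<Sum>j\<in>UNIV. \<alpha> j) = 1. if \<alpha> = \<delta> then \<Prod>j\<in>UNIV. (x $ j) ^ \<delta> j else 0)"
      unfolding form_of_def by (rule sum.cong) auto
    also have "\<dots> = (\<Prod>j\<in>UNIV. (x $ j) ^ \<delta> j)"
      using single by (subst sum.delta[OF fin]) (simp add: \<delta>_def)
    also have "\<dots> = (\<Prod>j\<in>UNIV. if j = i then x $ j else 1)"
      by (rule prod.cong) (auto simp: \<delta>_def)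
    finally show ?thesis by simp
  qed
  then have "(\<lambda>x. x $ i) = form_of 1 (\<lambda>\<alpha>. if \<alpha> = \<delta> then 1 else 0)"
    by (simp add: fun_eq_iff)
  then show ?thesis
    unfolding A1_def form_def by blast
qed

section \<open>Proportional vectors\<close>

text \<open>Zero is proportional to every vector, so relations between representatives survive at
  points where one of them vanishes. The price is that transitivity needs a nonzero middle
  term.\<close>

definition par :: "complex ^ 'n \<Rightarrow> complex ^ 'n \<Rightarrow> bool" where
  "par a b \<longleftrightarrow> (\<forall>i j. a $ i * b $ j = a $ j * b $ i)"

lemma par_scale_left: "par (s *s a) a"
  by (simp add: par_def)

lemma par_sym: "par a b \<Longrightarrow> par b a"
  by (simp add: par_def mult.commute)

lemma par_zero [simp]: "par 0 a" "par a 0"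
  by (simp_all add: par_def)

lemma parE:
  assumes "par a b" "b \<noteq> 0"
  obtains s where "a = s *s b"
proof -
  obtain j where j: "b $ j \<noteq> 0"
    using assms(2) by (auto simp: vec_eq_iff)
  have "a = (a $ j / b $ j) *s b"
    using assms(1) j by (simp add: par_def vec_eq_iff field_simps)
  then show ?thesis using that by blast
qed

lemma par_trans:
  assumes "par a b" "par b c" "b \<noteq> 0"
  shows "par a c"
proof -
  obtain s where "a = s *s b"
    using assms(1,3) by (rule parE)
  with assms(2) show ?thesis
    by (simp add: par_def)
qed

lemma par_matrix:
  assumes "par a b"
  shows "par (K *v a) (K *v b)"
proof (cases "b = 0")
  case False
  then obtain s where "a = s *s b"
    using assms parE by blast
  then show ?thesis
    by (simp add: vec.scale par_scale_left)
qed simp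

lemma par_smult_cancel: "s \<noteq> 0 \<Longrightarrow> par a (s *s b) \<longleftrightarrow> par a b"
  by (auto simp: par_def)

text \<open>This is how base points are found: at a contracted point the value of the inverse is
  proportional to two distinct points of the fibre.\<close>

lemma par_all_imp_zero:
  assumes "par a p" "par a q" "\<not> par p q"
  shows "a = 0"
  using par_trans[OF par_sym[OF assms(1)] assms(2)] assms(3) by blast

lemma same_map_par: "same_map F G \<Longrightarrow> par (F x) (G x)"
  by (simp add: same_map_def par_def)

text \<open>Proportionality is the vanishing of the 2x2 minors, which are polynomial
  functions.\<close>

lemma par_generic:
  assumes "\<And>i. polyfun (\<lambda>x. F x $ i)" "\<And>i. polyfun (\<lambda>x. G x $ i)"
    and "polyfun g" "g y \<noteq> 0" "\<And>x. g x \<noteq> 0 \<Longrightarrow> par (F x) (G x)"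
  shows "par (F x) (G x)"
  unfolding par_def
proof (intro allI)
  fix i j
  have "F x $ i * G x $ j - F x $ j * G x $ i = 0"
  proof (rule polyfun_zero_if_generically_zero[OF _ assms(3,4)])
    show "polyfun (\<lambda>x. F x $ i * G x $ j - F x $ j * G x $ i)"
      by (intro polyfun_diff polyfun.mult assms)
  qed (use assms(5) in \<open>auto simp: par_def\<close>)
  then show "F x $ i * G x $ j = F x $ j * G x $ i"
    by simp
qed

lemma par_trans_generic:
  assumes "\<And>i. polyfun (\<lambda>x. F x $ i)" "\<And>i. polyfun (\<lambda>x. G x $ i)" "\<And>i. polyfun (\<lambda>x. H x $ i)"
    and "\<And>x. par (F x) (G x)" "\<And>x. par (G x) (H x)" "G y \<noteq> 0"
  shows "par (F x) (H x)"
proof -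
  obtain k where "G y $ k \<noteq> 0"
    using assms(6) by (auto simp: vec_eq_iff)
  then show ?thesis
    by (rule par_generic[OF assms(1,3,2)]) (metis assms(4,5) par_trans zero_index)
qed

lemma polyfun_linear_form: "linear_form l \<Longrightarrow> polyfun l"
  using polyfun_sum[of UNIV "\<lambda>j x. l (axis j 1) * x $ j", OF polyfun.mult[OF polyfun.const polyfun.coord]]
  by (simp flip: linear_form_expand)

section \<open>Birational maps\<close>

lemma birational_forms:
  assumes "birational F"
  obtains d where "forms d F"
  using assms unfolding birational_def inverse_maps_def ratmap_def by blast

lemma birational_polyfun: "birational F \<Longrightarrow> polyfun (\<lambda>x. F x $ i)"
  using birational_forms polyfun_forms by metis

text \<open>The image lies in no hyperplane: a weak form of dominance that survives a change of
  representative.\<close>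

definition nondegenerate :: "('a \<Rightarrow> complex ^ 'n) \<Rightarrow> bool" where
  "nondegenerate F \<longleftrightarrow> (\<forall>w. linear_form w \<longrightarrow> (\<forall>x. w (F x) = 0) \<longrightarrow> (\<forall>x. w x = 0))"

lemma nondegenerateD:
  "nondegenerate F \<Longrightarrow> linear_form w \<Longrightarrow> (\<And>x. w (F x) = 0) \<Longrightarrow> w x = 0"
  by (simp add: nondegenerate_def)

text \<open>Off a proper closed subset every \<open>x\<close> is a multiple of
  \<open>F (G x)\<close>, so a form that kills the image of \<open>F\<close> kills almost every
  point.\<close>

lemma birational_nondegenerate:
  assumes "birational F"
  shows "nondegenerate F"
  unfolding nondegenerate_def
proof (intro allI impI)
  fix w x assume w: "linear_form w" "\<forall>x. w (F x) = 0"
  obtain G where "ratmap G" and FG: "same_map (F \<circ> G) id"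
    using assms(1) unfolding birational_def inverse_maps_def by blast
  then have G: "polyfun (\<lambda>x. G x $ i)" for i
    unfolding ratmap_def using polyfun_forms by blast
  obtain y where "F (G y) \<noteq> 0"
    using FG unfolding same_map_def by auto
  then obtain k where k: "F (G y) $ k \<noteq> 0"
    by (auto simp: vec_eq_iff)
  show "w x = 0"
  proof (rule polyfun_zero_if_generically_zero[where f = w and g = "\<lambda>x. F (G x) $ k"])
    show "polyfun (\<lambda>x. F (G x) $ k)"
      using polyfun_compose[OF birational_polyfun[OF assms(1)] G] .
    show "F (G y) $ k \<noteq> 0" by fact
    fix x assume x: "F (G x) $ k \<noteq> 0"
    then have "F (G x) \<noteq> 0" by auto
    moreover have "par x (F (G x))"
      using same_map_par[OF FG, of x] par_sym by auto
    ultimately obtain s where "x = s *s F (G x)"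
      using parE by blast
    then have "w x = s * w (F (G x))"
      using linear_form_simps(2)[OF w(1)] by metis
    then show "w x = 0"
      using w(2) by simp
  qed (rule polyfun_linear_form[OF w(1)])
qed

text \<open>Where the representatives do not vanish, \<open>G x\<close> is a multiple of
  \<open>G' x\<close>; homogeneity lets \<open>F\<close> carry a power of that factor outside, and
  this power is nonzero because \<open>F (G x)\<close> is.\<close>

lemma par_inverse_representatives:
  assumes F: "forms d F" and F': "\<And>i. polyfun (\<lambda>x. F' x $ i)"
    and G: "\<And>i. polyfun (\<lambda>x. G x $ i)" and G': "\<And>i. polyfun (\<lambda>x. G' x $ i)"
    and FF': "\<And>x. par (F x) (F' x)" and GG': "\<And>x. par (G x) (G' x)"
    and nz: "F (G y) \<noteq> 0" "G' z \<noteq> 0" and inv: "\<And>x. par (F (G x)) x"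
  shows "par (F' (G' x)) x"
proof -
  obtain j k where jk: "F (G y) $ j \<noteq> 0" "G' z $ k \<noteq> 0"
    using nz by (auto simp: vec_eq_iff)
  have pol: "polyfun (\<lambda>x. F (G x) $ j)" "polyfun (\<lambda>x. G' x $ k)"
    using polyfun_compose[OF polyfun_forms[OF F] G] G' by auto
  obtain w where w: "F (G w) $ j * G' w $ k \<noteq> 0"
    using polyfun_mult_nonzero[OF pol jk] by auto
  show ?thesis
  proof (rule par_generic[OF polyfun_compose[OF F' G'] polyfun.coord polyfun.mult[OF pol] w])
    fix x assume x: "F (G x) $ j * G' x $ k \<noteq> 0"
    then have "G' x \<noteq> 0" "F (G x) \<noteq> 0" by auto
    then obtain s where "G x = s *s G' x"
      using GG' parE by blast
    then have FG: "F (G x) = s ^ d *s F (G' x)"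
      using forms_homogeneous[OF F] by simp
    with \<open>F (G x) \<noteq> 0\<close> have "F (G' x) \<noteq> 0" "s ^ d \<noteq> 0" by auto
    then have "par (F (G' x)) x"
      using inv[of x] unfolding FG by (metis par_sym par_smult_cancel)
    then show "par (F' (G' x)) x"
      using par_trans[OF par_sym[OF FF'] _ \<open>F (G' x) \<noteq> 0\<close>] by blast
  qed
qed

section \<open>The normal form of a generic map with a double line\<close>

text \<open>Every \<open>x\<close> is moved into the plane \<open>l = 0\<close> along a vector
  \<open>e\<close> with \<open>l e = 1\<close>; expanding the vanishing value of the form there
  exhibits the factor \<open>l x\<close>.\<close>

lemma quadratic_form_divisible:
  assumes "\<And>x. linear_form (b x)" "\<And>y. linear_form (\<lambda>x. b x y)"
    and l: "linear_form l" "l \<noteq> (\<lambda>_. 0)" and zero: "\<And>x. l x = 0 \<Longrightarrow> b x x = 0"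
  obtains k where "linear_form k" "\<And>x. b x x = l x * k x"
proof -
  note b1 = linear_form_simps[OF assms(1)] and b2 = linear_form_simps[OF assms(2)]
    and ls = linear_form_simps[OF l(1)]
  obtain e' where e': "l e' \<noteq> 0"
    using l(2) by auto
  define e where "e = (1 / l e') *s e'"
  have e: "l e = 1"
    using e' by (simp add: e_def ls)
  define k where "k x = b x e + b e x - l x * b e e" for x
  have "linear_form k"
    unfolding linear_form_def k_def by (simp add: b1 b2 ls algebra_simps)
  moreover have "b x x = l x * k x" for x
  proof -
    have "b (x - l x *s e) (x - l x *s e) = 0"
      by (rule zero) (simp add: ls e)
    then show ?thesis
      by (simp add: b1 b2 k_def algebra_simps)
  qed
  ultimately show ?thesis using that by blast
qed

lemma matrix_of_linear_forms:
  fixes m :: "'m::finite \<Rightarrow> complex ^ 'n \<Rightarrow> complex"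
  assumes "\<And>i. linear_form (m i)"
  obtains T :: "complex ^ 'n ^ 'm" where "\<And>x i. (T *v x) $ i = m i x"
proof
  show "((\<chi> i j. m i (axis j 1)) *v x) $ i = m i x" for x i
    by (simp add: matrix_vector_mult_def linear_form_expand[OF assms, of i x])
qed

text \<open>Modulo \<open>l\<close> the form \<open>m\<close> with \<open>q = m\<^sup>2\<close> on the plane \<open>l = 0\<close> can be replaced by the
  combination \<open>u\<close> of \<open>l\<close> and \<open>m\<close> that vanishes at \<open>p\<close>.\<close>

lemma double_line_normal_form:
  fixes p :: "complex ^ 4"
  assumes Q: "\<And>i. \<exists>m\<in>A1. \<exists>c. \<forall>x. Q x $ i = l x * m x + c * q x"
    and dl: "double_line l q C" and lp: "l p \<noteq> 0" and Qp: "Q p = 0"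
  obtains T :: "complex ^ 4 ^ 4" and c u where
    "linear_form l" "linear_form u" "u \<noteq> (\<lambda>_. 0)" "u p = 0" "C = {x. l x = 0 \<and> u x = 0}"
    "T *v p = 0" "\<And>x. Q x = l x *s (T *v x) + (u x)\<^sup>2 *s c"
proof -
  obtain m where m: "m \<in> A1" and mq: "\<And>x. l x = 0 \<Longrightarrow> q x = (m x)\<^sup>2"
    and C: "C = {x. l x = 0 \<and> m x = 0}" and l: "l \<in> A1" "l \<noteq> (\<lambda>_. 0)" and q: "form 2 q"
    and nz: "\<exists>x. l x = 0 \<and> q x \<noteq> 0"
    using dl unfolding double_line_def plane_conic_def by blast
  note ml = A1_linear_form[OF m] and ll = A1_linear_form[OF l(1)]
  note ms = linear_form_simps[OF ml] and ls = linear_form_simps[OF ll]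
  obtain b where b: "\<And>x. linear_form (b x)" "\<And>y. linear_form (\<lambda>x. b x y)" "\<And>x. q x = b x x"
    using form_2_bilinear[OF q] by blast
  \<comment> \<open>\<open>b'\<close> polarizes the difference of \<open>q\<close> and the square of
    \<open>m\<close>, which vanishes on the plane \<open>l = 0\<close>.\<close>
  define b' where "b' x y = b x y - m x * m y" for x y
  have "linear_form (b' x)" "linear_form (\<lambda>x. b' x y)" for x y
    unfolding linear_form_def b'_def
    by (simp_all add: linear_form_simps[OF b(1)] linear_form_simps[OF b(2)] ms algebra_simps)
  moreover have "b' x x = 0" if "l x = 0" for x
    using mq[OF that] b(3) by (simp add: b'_def power2_eq_square)
  ultimately obtain k where k: "linear_form k" "\<And>x. b' x x = l x * k x"
    using quadratic_form_divisible[OF _ _ ll l(2)] by blast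
  define r where "r = m p / l p"
  define u where "u x = m x - r * l x" for x
  have ul: "linear_form u"
    unfolding u_def using linear_form_lincomb[OF ml ll, of 1 "- r"] by simp
  have up: "u p = 0"
    using lp by (simp add: u_def r_def)
  have Cu: "C = {x. l x = 0 \<and> u x = 0}"
    by (auto simp: C u_def)
  \<comment> \<open>If \<open>u\<close> were zero, \<open>m\<close> would be a multiple of
    \<open>l\<close>, so \<open>q\<close> would vanish on the whole plane, which
    \<open>plane_conic\<close> excludes.\<close>
  have un: "u \<noteq> (\<lambda>_. 0)"
    using nz mq by (force simp: u_def fun_eq_iff)
  have qx: "q x = (u x)\<^sup>2 + l x * (k x + 2 * r * u x + r\<^sup>2 * l x)" for x
  proof -
    have "q x = (m x)\<^sup>2 + l x * k x"
      using k(2)[of x] b(3)[of x] by (simp add: b'_def power2_eq_square algebra_simps)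
    moreover have "m x = u x + r * l x"
      by (simp add: u_def)
    ultimately show ?thesis
      by (simp add: power2_eq_square algebra_simps)
  qed
  obtain M c where Mc: "\<And>i. M i \<in> A1" "\<And>i x. Q x $ i = l x * M i x + c i * q x"
    using Q by metis
  define m' where "m' i x = M i x + c i * (k x + 2 * r * u x + r\<^sup>2 * l x)" for i x
  have "linear_form (m' i)" for i
    unfolding linear_form_def m'_def
    by (simp add: linear_form_simps[OF k(1)] linear_form_simps[OF ul] ls
        linear_form_simps[OF A1_linear_form[OF Mc(1)]] algebra_simps)
  then obtain T where T: "\<And>x i. (T *v x) $ i = m' i x"
    using matrix_of_linear_forms by metis
  have Qx: "Q x = l x *s (T *v x) + (u x)\<^sup>2 *s (\<chi> i. c i)" for x
    by (simp add: vec_eq_iff T Mc(2) qx m'_def algebra_simps)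
  have "T *v p = 0"
    using Qx[of p] Qp up lp by simp
  then show ?thesis
    using that[OF ll ul un up Cu _ Qx] by blast
qed

lemma form_zero_if_zero_nearby:
  assumes "form d f" "\<And>e. e \<noteq> 0 \<Longrightarrow> f (x + e *s y) = 0"
  shows "f x = 0"
proof (rule ccontr)
  assume "f x \<noteq> 0"
  then have "\<forall>\<^sub>F e in at 0. f (x + e *s y) \<noteq> 0"
    by (rule polyfun_eventually_nonzero_on_line[OF polyfun_form[OF assms(1)]])
  then have "\<forall>\<^sub>F e in at (0 :: complex). False"
    by (rule eventually_mono[OF eventually_conj[OF _ eventually_neq_at_within[of 0]]]) (use assms(2) in blast)
  then show False
    by simp
qed

text \<open>Padding the three forms with the zero form gives a 4x4 matrix that is not surjective,
  hence not injective.\<close>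

lemma three_linear_forms_common_zero:
  fixes f g h :: "complex ^ 4 \<Rightarrow> complex"
  assumes "linear_form f" "linear_form g" "linear_form h"
  shows "\<exists>x. x \<noteq> 0 \<and> f x = 0 \<and> g x = 0 \<and> h x = 0"
proof -
  define m where "m i = (if i = 1 then f else if i = 2 then g else if i = 3 then h else (\<lambda>_. 0))"
    for i :: 4
  have "linear_form (m i)" for i
    using assms by (auto simp: m_def linear_form_def)
  then obtain T where T: "\<And>x i. (T *v x) $ i = m i x"
    using matrix_of_linear_forms by metis
  have "(T *v x) $ 4 = 0" for x
    by (simp add: T m_def)
  then have "axis 4 1 \<noteq> T *v x" for x
    using axis_nth[of 4 "1 :: complex"] by (metis zero_neq_one)
  then have "\<not> surj ((*v) T)"
    unfolding surj_def by blast
  then have "\<not> (\<exists>B. T ** B = mat 1)"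
    using matrix_right_invertible_surjective[of T] by auto
  then obtain x where x: "x \<noteq> 0" "T *v x = 0"
    using matrix_left_right_inverse[of T] matrix_left_invertible_ker[of T] by blast
  have "m i x = 0" for i
    using T[of x i] x(2) by simp
  from this[of 1] this[of 2] this[of 3] x(1) show ?thesis
    by (auto simp: m_def)
qed

text \<open>A coordinate that does not vanish at \<open>p\<close> is used as third form; its zeros
  exclude the nonzero multiples of \<open>p\<close>.\<close>

lemma second_point_on_line:
  fixes p :: "complex ^ 4"
  assumes "linear_form f" "linear_form g" "p \<noteq> 0"
  obtains w where "w \<noteq> 0" "f w = 0" "g w = 0" "\<not> par w p"
proof -
  obtain j where j: "p $ j \<noteq> 0"
    using assms(3) by (auto simp: vec_eq_iff)
  have "linear_form (\<lambda>x :: complex ^ 4. x $ j)"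
    by (simp add: linear_form_def)
  then obtain w where w: "w \<noteq> 0" "f w = 0" "g w = 0" "w $ j = 0"
    using three_linear_forms_common_zero[OF assms(1,2)] by blast
  have "\<not> par w p"
  proof
    assume "par w p"
    then obtain s where "w = s *s p"
      using assms(3) by (rule parE)
    with w(1,4) j show False
      by auto
  qed
  with w that show ?thesis by blast
qed

lemma in_span_singleton_iff: "x \<in> vec.span {p} \<longleftrightarrow> (\<exists>s. x = s *s p)"
  by (auto simp: vec.span_singleton)

text \<open>\<open>generic22\<close> asserts genericity for some point and conic, whereas the normal
  form is wanted for the given ones. The two descriptions are compared through the indeterminacy
  locus; this puts \<open>p\<close> off the line \<open>C\<close>, and then off the plane
  \<open>l = 0\<close>.\<close>

lemma generic22_normal_form:
  assumes gen: "generic22 F" and PI: "is_PI F p" and CI: "is_CI F l q" and dl: "double_line l q C"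
  obtains Q and T :: "complex ^ 4 ^ 4" and c u where
    "forms 2 Q" "same_map F Q" "l p \<noteq> 0"
    "linear_form l" "linear_form u" "u \<noteq> (\<lambda>_. 0)" "u p = 0" "C = {x. l x = 0 \<and> u x = 0}"
    "T *v p = 0" "\<And>x. Q x = l x *s (T *v x) + (u x)\<^sup>2 *s c"
proof -
  obtain m where m: "m \<in> A1" and mq: "\<And>x. l x = 0 \<Longrightarrow> q x = (m x)\<^sup>2"
    and C: "C = {x. l x = 0 \<and> m x = 0}" and l: "l \<in> A1"
    using dl unfolding double_line_def plane_conic_def by blast
  note ml = A1_linear_form[OF m] and ll = A1_linear_form[OF l(1)]
  note ms = linear_form_simps[OF ml] and ls = linear_form_simps[OF ll]
  have CC: "conic_points l q = C - {0}"
    using mq by (auto simp: conic_points_def C)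
  have p0: "p \<noteq> 0"
    using PI by (simp add: is_PI_def)
  have span_eq: "vec.span {p'} - {0} = vec.span {p} - {0}" if "is_PI F p'" for p'
    using that PI by (auto simp: is_PI_def)
  obtain Q where red: "reduced_rep 2 F Q" and Qi: "\<And>i. \<exists>m\<in>A1. \<exists>c. \<forall>x. Q x $ i = l x * m x + c * q x"
    using CI unfolding is_CI_def by blast
  have ind: "indeterminacy F = (C - {0}) \<union> (vec.span {p} - {0})"
  proof -
    obtain p1 where "is_PI F p1" "indeterminacy F = conic_points l q \<union> (vec.span {p1} - {0})"
      using CI unfolding is_CI_def by blast
    then show ?thesis
      using span_eq CC by simp
  qed
  have Q: "forms 2 Q" "same_map F Q" and ncf: "no_common_factor 2 Q"
    using red by (auto simp: reduced_rep_def)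
  have "p \<in> indeterminacy F"
    using p0 by (simp add: ind vec.span_base)
  then have Qp: "Q p = 0"
    using Q p0 unfolding indeterminacy_def image_at_def by blast
  obtain p2 l2 q2 where p2: "is_PI F p2" and CI2: "is_CI F l2 q2" and p2n: "p2 \<notin> conic_points l2 q2"
    using gen unfolding generic22_def by blast
  have p20: "p2 \<noteq> 0"
    using p2 by (simp add: is_PI_def)
  have ind2: "indeterminacy F = conic_points l2 q2 \<union> (vec.span {p2} - {0})"
  proof -
    obtain p1 where "is_PI F p1" "indeterminacy F = conic_points l2 q2 \<union> (vec.span {p1} - {0})"
      using CI2 unfolding is_CI_def by blast
    then show ?thesis
      using span_eq span_eq[OF p2] by simp
  qed
  \<comment> \<open>If \<open>p2\<close> were on \<open>C\<close>, points of \<open>C\<close> near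
    it would be indeterminate without being multiples of \<open>p2\<close>, hence on the second
    conic; by continuity \<open>p2\<close> would lie there too.\<close>
  have "p2 \<notin> C"
  proof
    assume "p2 \<in> C"
    then have p2C: "l p2 = 0" "m p2 = 0"
      by (auto simp: C)
    obtain w where w: "w \<noteq> 0" "l w = 0" "m w = 0" "\<not> par w p2"
      using second_point_on_line[OF ll ml p20] by blast
    have near: "p2 + e *s w \<in> conic_points l2 q2" if e: "e \<noteq> 0" for e
    proof -
      have nsp: "p2 + e *s w \<notin> vec.span {p2}"
      proof
        assume "p2 + e *s w \<in> vec.span {p2}"
        then obtain s where "p2 + e *s w = s *s p2"
          unfolding in_span_singleton_iff by blast
        then have "e *s w = (s - 1) *s p2"
          by (simp add: vector_sub_rdistrib algebra_simps)
        then have "w = ((s - 1) / e) *s p2"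
          using e by (auto simp: vec_eq_iff field_simps)
        then show False
          using w(4) par_scale_left by blast
      qed
      moreover have "p2 + e *s w \<in> C"
        by (simp add: C p2C w ls ms)
      moreover have "p2 + e *s w \<noteq> 0"
        using nsp vec.span_zero[of "{p2}"] by auto
      ultimately have "p2 + e *s w \<in> indeterminacy F"
        by (simp add: ind)
      with nsp show ?thesis
        by (simp add: ind2)
    qed
    have "form 1 l2" "form 2 q2"
      using CI2 by (auto simp: is_CI_def plane_conic_def A1_def)
    then have "l2 p2 = 0" "q2 p2 = 0"
      using form_zero_if_zero_nearby[where x = p2 and y = w] near by (auto simp: conic_points_def)
    then show False
      using p2n p20 by (simp add: conic_points_def)
  qed
  have pC: "p \<notin> C"
  proof
    assume "p \<in> C"
    moreover obtain s where "p2 = s *s p"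
      using span_eq[OF p2] p20 vec.span_base[of p2 "{p2}"] in_span_singleton_iff by blast
    ultimately show False
      using \<open>p2 \<notin> C\<close> by (simp add: C ls ms)
  qed
  \<comment> \<open>A point of the plane off \<open>C\<close> has \<open>q p \<noteq> 0\<close>, so
    the vanishing of \<open>Q\<close> at \<open>p\<close> removes \<open>q\<close> from every
    component and leaves \<open>l\<close> as a common factor.\<close>
  have lp: "l p \<noteq> 0"
  proof
    assume lp: "l p = 0"
    then have qp: "q p \<noteq> 0"
      using pC mq by (auto simp: C)
    obtain M c where Mc: "\<And>i. M i \<in> A1" "\<And>i x. Q x $ i = l x * M i x + c i * q x"
      using Qi by metis
    have "c i = 0" for i
      using Mc(2)[of p i] lp qp Qp by simp
    then have "Q = (\<lambda>x. l x *s (\<chi> i. M i x))"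
      by (simp add: fun_eq_iff vec_eq_iff Mc(2))
    moreover have "forms (2 - 1) (\<lambda>x. \<chi> i. M i x)"
      using Mc(1) by (simp add: forms_def A1_def)
    moreover have "form 1 l"
      using l by (simp add: A1_def)
    ultimately show False
      using ncf unfolding no_common_factor_def
      by (elim notE) (intro exI[of _ 1] exI[of _ l] exI conjI; simp)
  qed
  show ?thesis
    by (rule double_line_normal_form[OF Qi dl lp Qp]) (rule that[OF Q lp])
qed

text \<open>Adding to \<open>T\<close> a rank one map that takes \<open>p\<close> to
  \<open>c\<close> gives a matrix \<open>M\<close>. A form that kills the range of \<open>M\<close>
  kills \<open>c = M p\<close>, then the range of \<open>T\<close>, then the image of
  \<open>Q\<close>; so \<open>M\<close> is invertible by nondegeneracy.\<close>

lemma normal_form_injective: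
  fixes T :: "complex ^ 4 ^ 4"
  assumes Q: "\<And>x. Q x = l x *s (T *v x) + (u x)\<^sup>2 *s c"
    and dom: "nondegenerate Q"
    and l: "linear_form l" "l p \<noteq> 0" and Tp: "T *v p = 0"
  shows "c \<noteq> 0" and "\<And>z s. T *v z = s *s c \<Longrightarrow> \<exists>r. z = r *s p"
proof -
  define v where "v z = l z / l p" for z
  have vl: "linear_form v" and vp: "v p = 1"
    using l by (auto simp: v_def linear_form_def add_divide_distrib)
  note vs = linear_form_simps[OF vl]
  have "linear_form (\<lambda>z. (T *v z) $ i + v z * c $ i)" for i
    unfolding linear_form_def by (simp add: vec.add vec.scale vs algebra_simps)
  then obtain M :: "complex ^ 4 ^ 4" where M': "\<And>z i. (M *v z) $ i = (T *v z) $ i + v z * c $ i"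
    using matrix_of_linear_forms[of "\<lambda>i z. (T *v z) $ i + v z * c $ i"] by blast
  have M: "M *v z = T *v z + v z *s c" for z
    by (simp add: vec_eq_iff M')
  have "\<exists>B. M ** B = mat 1"
    unfolding matrix_right_invertible_independent_rows
  proof (intro allI impI)
    fix a i assume a: "(\<Sum>i\<in>UNIV. a i *s row i M) = 0"
    define w where "w x = (\<Sum>i\<in>UNIV. a i * x $ i)" for x :: "complex ^ 4"
    have wl: "linear_form w"
      unfolding w_def linear_form_def by (simp add: sum.distrib sum_distrib_left algebra_simps)
    note ws = linear_form_simps[OF wl]
    have wM: "w (M *v z) = 0" for z
    proof -
      have "w (M *v z) = (\<Sum>i\<in>UNIV. \<Sum>j\<in>UNIV. a i * M $ i $ j * z $ j)"
        by (simp add: w_def matrix_vector_mult_def sum_distrib_left mult.assoc)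
      also have "\<dots> = (\<Sum>j\<in>UNIV. \<Sum>i\<in>UNIV. a i * M $ i $ j * z $ j)"
        by (rule sum.swap)
      also have "\<dots> = (\<Sum>j\<in>UNIV. (\<Sum>i\<in>UNIV. a i *s row i M) $ j * z $ j)"
        by (simp add: row_def sum_distrib_right)
      finally show ?thesis
        by (simp add: a)
    qed
    have wc: "w c = 0"
      using wM[of p] by (simp add: M Tp vp)
    have "w (T *v z) = 0" for z
      using wM[of z] by (simp add: M ws wc)
    then have "w (Q x) = 0" for x
      by (simp add: Q ws wc)
    then have "w (axis i 1) = 0"
      by (rule nondegenerateD[OF dom wl])
    then show "a i = 0"
      by (simp add: w_def axis_def if_distrib cong: if_cong)
  qed
  then have ker: "M *v z = 0 \<Longrightarrow> z = 0" for z
    using matrix_left_right_inverse[of M] matrix_left_invertible_ker[of M] by blast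
  show "\<exists>r. z = r *s p" if "T *v z = s *s c" for z s
  proof -
    \<comment> \<open>Since \<open>M\<close> sends \<open>p\<close> to \<open>c\<close>, subtracting
      \<open>(v z + s) *s p\<close> cancels exactly the multiple of \<open>c\<close> that
      \<open>M *v z\<close> is.\<close>
    have "M *v (z - (v z + s) *s p) = 0"
      unfolding M by (simp add: vec.diff vec.scale Tp that vs vp algebra_simps vector_smult_lneg
          vector_sadd_rdistrib flip: vector_smult_assoc)
    then have "z - (v z + s) *s p = 0"
      by (rule ker)
    then have "z = (v z + s) *s p"
      by (simp only: right_minus_eq)
    then show ?thesis ..
  qed
  show "c \<noteq> 0"
    using ker[of p] l(2) linear_form_simps(3)[OF l(1)] by (auto simp: M Tp)
qed

lemma normal_form_base_locus:
  fixes T :: "complex ^ 4 ^ 4"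
  assumes "l z *s (T *v z) + (u z)\<^sup>2 *s c = 0" and "c \<noteq> 0"
    and inj: "\<And>z s. T *v z = s *s c \<Longrightarrow> \<exists>r. z = r *s p"
  shows "(l z = 0 \<and> u z = 0) \<or> (\<exists>r. z = r *s p)"
proof (cases "l z = 0")
  case True
  then show ?thesis
    using assms(1,2) by simp
next
  case False
  then have "T *v z = (- (u z)\<^sup>2 / l z) *s c"
    using assms(1) by (simp add: vec_eq_iff field_simps eq_neg_iff_add_eq_0)
  then show ?thesis
    using inj by blast
qed

lemma injective_on_line_surjective:
  fixes T :: "complex ^ 4 ^ 4"
  assumes l: "linear_form l" and u: "linear_form u" and C: "C = {x. l x = 0 \<and> u x = 0}"
    and inj: "\<And>z. z \<in> C \<Longrightarrow> T *v z = 0 \<Longrightarrow> z = 0" and TC: "\<And>w. w \<in> C \<Longrightarrow> T *v w \<in> C"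
  shows "(*v) T ` C = C"
proof (rule vec.subspace_dim_equal)
  show sub: "vec.subspace C"
    by (auto simp: C vec.subspace_def linear_form_simps[OF l] linear_form_simps[OF u])
  show "vec.subspace ((*v) T ` C)"
    by (rule vec.subspace_image[OF sub])
  show "(*v) T ` C \<subseteq> C"
    using TC by blast
  have "inj_on ((*v) T) C"
  proof (rule inj_onI)
    fix x y assume xy: "x \<in> C" "y \<in> C" "T *v x = T *v y"
    then have "T *v (x - y) = 0"
      by (simp add: vec.diff)
    then show "x = y"
      using inj[of "x - y"] vec.subspace_diff[OF sub xy(1,2)] by simp
  qed
  then have "inj_on ((*v) T) (vec.span C)"
    by (simp add: vec.span_eq_iff[THEN iffD2, OF sub])
  then have "vec.dim ((*v) T ` C) = vec.dim C"
    by (rule vec.dim_image_eq[OF matrix_vector_mul_linear_gen])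
  then show "vec.dim C \<le> vec.dim ((*v) T ` C)"
    by simp
qed

text \<open>The inverse has the same base locus \<open>C \<union> {p}\<close>.  A map in normal form contracts the plane
  \<open>l = 0\<close> to \<open>c\<close> and the plane \<open>u = 0\<close> onto \<open>T C\<close>, and contracted points have to lie in the base
  locus of the inverse.\<close>

lemma normal_form_preserves_base_locus:
  fixes T T' :: "complex ^ 4 ^ 4" and p :: "complex ^ 4"
  assumes l: "linear_form l" "l p \<noteq> 0" and u: "linear_form u" "u p = 0" "u \<noteq> (\<lambda>_. 0)"
    and C: "C = {x. l x = 0 \<and> u x = 0}" and Tp: "T *v p = 0" and c0: "c \<noteq> 0"
    and inj: "\<And>z s. T *v z = s *s c \<Longrightarrow> \<exists>r. z = r *s p"
    and l': "linear_form l'" and u': "linear_form u'" 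
    and C': "C = {x. l' x = 0 \<and> u' x = 0}" and c0': "c' \<noteq> 0"
    and inj': "\<And>z s. T' *v z = s *s c' \<Longrightarrow> \<exists>r. z = r *s p"
    and Q: "\<And>x. Q x = l x *s (T *v x) + (u x)\<^sup>2 *s c"
    and Q': "\<And>x. Q' x = l' x *s (T' *v x) + (u' x)\<^sup>2 *s c'"
    and inv: "\<And>x. par (Q' (Q x)) x"
  shows "(*v) T ` C = C" and "\<exists>k. c = k *s p"
proof -
  note ls = linear_form_simps[OF l(1)] and us = linear_form_simps[OF u(1)]
  have base: "z \<in> C \<or> (\<exists>r. z = r *s p)" if "Q' z = 0" for z
  proof -
    have "l' z *s (T' *v z) + (u' z)\<^sup>2 *s c' = 0"
      using that Q' by simp
    then have "(l' z = 0 \<and> u' z = 0) \<or> (\<exists>r. z = r *s p)"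
      using c0' inj' by (rule normal_form_base_locus)
    then show ?thesis
      using C' by blast
  qed
  have Cp: "r *s p \<in> C \<Longrightarrow> r = 0" for r
    using l(2) by (simp add: C ls)
  have injC: "w = 0" if w: "w \<in> C" "T *v w = 0" for w
  proof -
    obtain r where "w = r *s p"
      using inj[of w 0] w(2) by auto
    with Cp w(1) show ?thesis by auto
  qed
  have Q'hom: "Q' (s *s z) = s\<^sup>2 *s Q' z" for s z
    by (simp add: Q' linear_form_simps[OF l'] linear_form_simps[OF u'] vec.scale vec_eq_iff
        power2_eq_square algebra_simps)
  have p0: "p \<noteq> 0"
    using l(2) ls by auto
  \<comment> \<open>A point of the plane \<open>l = 0\<close> off \<open>C\<close>, normalized so
    that \<open>Q\<close> takes the value \<open>c\<close> there; adding a vector of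
    \<open>C\<close> does not change this value.\<close>
  obtain z1 where z1: "l z1 = 0" "u z1 = 1"
  proof -
    obtain z where z: "u z \<noteq> 0"
      using u(3) by auto
    then show ?thesis
      using that[of "(1 / u z) *s (z - (l z / l p) *s p)"] l(2) u(2) by (simp add: ls us)
  qed
  obtain w where w: "w \<noteq> 0" "w \<in> C"
    using second_point_on_line[OF l(1) u(1) p0] by (auto simp: C)
  have c_base: "c \<in> C \<or> (\<exists>r. c = r *s p)"
  proof (rule base)
    have "Q z1 = c" "Q (z1 + w) = c"
      using w(2) by (auto simp: Q C ls us z1)
    then have "par (Q' c) z1" "par (Q' c) (z1 + w)"
      using inv by metis+
    moreover have "\<not> par z1 (z1 + w)"
    proof
      assume par: "par z1 (z1 + w)"
      have nz: "z1 \<noteq> 0"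
        using z1 us(3) by auto
      obtain s where s: "z1 + w = s *s z1"
        by (rule parE[OF par_sym[OF par] nz])
      have "u (z1 + w) = 1"
        using w(2) by (simp add: us z1 C)
      then have "s = 1"
        by (simp add: s us z1)
      with s w(1) show False by simp
    qed
    ultimately show "Q' c = 0"
      by (rule par_all_imp_zero)
  qed
  \<comment> \<open>\<open>Q\<close> sends \<open>w + k *s p\<close> to \<open>l (k *s p)\<close>
    times \<open>T *v w\<close>, so the line from \<open>w\<close> to \<open>p\<close> is
    contracted; \<open>s\<close> normalizes \<open>l\<close> so that two of its points have the
    values \<open>T *v w\<close> and twice that.\<close>
  have TC_base: "T *v w \<in> C \<or> (\<exists>r. T *v w = r *s p)" if w: "w \<in> C" for w
  proof (cases "w = 0")
    case False
    define s where "s = 1 / l p"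
    have sl: "s * l p = 1"
      using l(2) by (simp add: s_def)
    have "Q (w + s *s p) = T *v w" "Q (w + (2 * s) *s p) = 2 *s (T *v w)"
      using w sl by (auto simp: Q C ls us u(2) vec.add vec.scale Tp)
    then have 0: "par (Q' (T *v w)) (w + s *s p)" "par (2\<^sup>2 *s Q' (T *v w)) (w + (2 * s) *s p)"
      using inv Q'hom by metis+
    have 2: "par (Q' (T *v w)) (w + (2 * s) *s p)"
      using 0(2) by (simp add: par_def)
    have "\<not> par (w + s *s p) (w + (2 * s) *s p)"
    proof
      assume par: "par (w + s *s p) (w + (2 * s) *s p)"
      have ls1: "l (w + s *s p) = 1" and ls2: "l (w + (2 * s) *s p) = 2"
        using w sl by (auto simp: C ls)
      have nz: "w + s *s p \<noteq> 0"
        using ls1 ls(3) by auto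
      obtain k where k: "w + (2 * s) *s p = k *s (w + s *s p)"
        by (rule parE[OF par_sym[OF par] nz])
      have "k = 2"
        using arg_cong[OF k, of l] unfolding ls(2)[of k] ls1 ls2 by simp
      have "w $ i = 0" for i
        using arg_cong[OF k, of "\<lambda>v. v $ i"] by (simp add: \<open>k = 2\<close> algebra_simps)
      then have "w = 0"
        by (simp add: vec_eq_iff)
      with False show False ..
    qed
    then have "Q' (T *v w) = 0"
      using par_all_imp_zero[OF 0(1) 2] by blast
    then show ?thesis
      by (rule base)
  qed (simp add: C ls us)
  \<comment> \<open>\<open>T\<close> maps \<open>C\<close> linearly into the union of
    \<open>C\<close> and the multiples of \<open>p\<close>. If \<open>w\<close> leaves
    \<open>C\<close>, injectivity keeps an independent \<open>w1\<close> inside, and the image of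
    \<open>w + w1\<close> could then lie in neither piece.\<close>
  have TC: "T *v w \<in> C" if w: "w \<in> C" for w
  proof (rule ccontr)
    assume n: "T *v w \<notin> C"
    then obtain a where a: "T *v w = a *s p"
      using TC_base[OF w] by blast
    have a0: "a \<noteq> 0"
      using n a by (auto simp: C ls us)
    have w0: "w \<noteq> 0"
      using n by (auto simp: C ls us)
    obtain w1 where w1: "w1 \<noteq> 0" "w1 \<in> C" "\<not> par w1 w"
      using second_point_on_line[OF l(1) u(1) w0] by (auto simp: C)
    have "T *v w1 \<in> C"
    proof (rule ccontr)
      assume "T *v w1 \<notin> C"
      then obtain b where b: "T *v w1 = b *s p"
        using TC_base[OF w1(2)] by blast
      have "T *v (a *s w1 - b *s w) = 0"
        by (simp add: vec.diff vec.scale a b vector_smult_assoc mult.commute)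
      moreover have "a *s w1 - b *s w \<in> C"
        using w w1(2) by (simp add: C ls us)
      ultimately have "a *s w1 - b *s w = 0"
        using injC by blast
      then have "w1 = (b / a) *s w"
        using a0 by (simp add: vec_eq_iff field_simps)
      then show False
        using w1(3) par_scale_left by blast
    qed
    moreover have "T *v (w + w1) \<notin> C"
    proof
      assume "T *v (w + w1) \<in> C"
      with \<open>T *v w1 \<in> C\<close> have "T *v (w + w1) - T *v w1 \<in> C"
        by (simp add: C ls us)
      with n show False
        by (simp add: vec.add)
    qed
    moreover have "w + w1 \<in> C"
      using w w1(2) by (simp add: C ls us)
    ultimately obtain r where "T *v (w + w1) = r *s p"
      using TC_base by blast
    then have "T *v w1 = (r - a) *s p"
      by (simp add: vec.add a vector_sub_rdistrib eq_diff_eq add.commute)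
    with \<open>T *v w1 \<in> C\<close> have "T *v w1 = 0"
      using Cp[of "r - a"] by auto
    then show False
      using injC w1(1,2) by blast
  qed
  show TCC: "(*v) T ` C = C"
    by (rule injective_on_line_surjective[OF l(1) u(1) C]) (use injC TC in blast)+
  \<comment> \<open>Otherwise \<open>c\<close> would have a preimage in \<open>C\<close>, which
    \<open>inj\<close> makes a multiple of \<open>p\<close> and hence zero.\<close>
  have "c \<notin> C"
  proof
    assume "c \<in> C"
    then obtain w where w: "w \<in> C" "T *v w = c"
      using TCC by (metis imageE)
    then obtain r where "w = r *s p"
      using inj[of w 1] by auto
    with w Cp have "w = 0" by auto
    with w(2) c0 show False by auto
  qed
  with c_base show "\<exists>k. c = k *s p" by blast
qed

section \<open>The induced projectivities\<close>

lemma invertible_if_trivial_kernel: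
  fixes X :: "complex ^ 'n ^ 'n"
  assumes "\<And>x. X *v x = 0 \<Longrightarrow> x = 0"
  shows "invertible X"
  unfolding invertible_left_inverse matrix_left_invertible_ker using assms by blast

text \<open>The plane \<open>l = 0\<close> moves with the parameter, so a fixed second equation
  \<open>h\<close> of \<open>C\<close> is kept beside \<open>u\<close>. It is normalized at
  \<open>p\<close>, as \<open>u\<close> is at \<open>z0\<close>, which decomposes every vector along
  \<open>C\<close>, \<open>p\<close> and \<open>z0\<close>.\<close>

locale point_and_line =
  fixes p :: "complex ^ 4" and C :: "(complex ^ 4) set" and h u :: "complex ^ 4 \<Rightarrow> complex"
    and z0 :: "complex ^ 4" and A :: "complex ^ 4 ^ 3" and B :: "complex ^ 4 ^ 2"
  assumes h: "linear_form h" and u: "linear_form u"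
    and hp: "h p = 1" and up: "u p = 0" and uz0: "u z0 = 1"
    and C_eq: "C = {x. h x = 0 \<and> u x = 0}"
    and ker_A: "{x. A *v x = 0} = vec.span {p}" and ker_B: "{x. B *v x = 0} = C"
begin

lemmas h_simps = linear_form_simps[OF h] and u_simps = linear_form_simps[OF u]

lemma A_zero_iff: "A *v x = 0 \<longleftrightarrow> (\<exists>r. x = r *s p)"
  using ker_A by (simp add: set_eq_iff in_span_singleton_iff)

lemma B_zero_iff: "B *v x = 0 \<longleftrightarrow> x \<in> C"
  using ker_B by (simp add: set_eq_iff)

lemma Ap: "A *v p = 0"
  unfolding A_zero_iff by (rule exI[of _ 1]) simp

lemma C_p_decomp: "x - u x *s z0 - h (x - u x *s z0) *s p \<in> C"
  by (simp add: C_eq h_simps u_simps hp up uz0)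

lemma linear_form_vanishing_on_C_p:
  assumes f: "linear_form f" "f p = 0" "\<And>x. x \<in> C \<Longrightarrow> f x = 0"
  shows "f z = f z0 * u z"
  using assms(3)[OF C_p_decomp[of z]] f(2) by (simp add: linear_form_simps[OF f(1)])

lemma matrix_vanishing_on_C_p:
  fixes K :: "complex ^ 4 ^ 'm"
  assumes "K *v p = 0" "\<And>x. x \<in> C \<Longrightarrow> K *v x = 0"
  shows "K *v z = u z *s (K *v z0)"
  using assms(2)[OF C_p_decomp[of z]] assms(1) by (simp add: vec.diff vec.scale)

text \<open>\<open>u\<close> kills the kernel of \<open>A\<close>, so it descends to the net of
  lines, and \<open>A'\<close> makes the descended form explicit. With its counterpart on the pencil
  it gives a coordinate shared by both projections.\<close>

lemma u_A_right_inverse: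
  assumes "A ** A' = mat 1"
  shows "u (A' *v (A *v x)) = u x"
proof -
  have "A *v (A' *v (A *v x) - x) = 0"
    by (simp add: vec.diff matrix_vector_mul_assoc matrix_mul_assoc assms)
  then show ?thesis
    unfolding A_zero_iff by (auto dest: arg_cong[of _ _ u] simp: u_simps up)
qed

lemma u_B_right_inverse:
  assumes "B ** B' = mat 1"
  shows "u (B' *v (B *v x)) = u x"
proof -
  have "B *v (B' *v (B *v x) - x) = 0"
    by (simp add: vec.diff matrix_vector_mul_assoc matrix_mul_assoc assms)
  then show ?thesis
    unfolding B_zero_iff by (simp add: C_eq u_simps)
qed

text \<open>Appending \<open>h\<close> to the three rows of \<open>A\<close> gives a square matrix
  with trivial kernel, since \<open>h p = 1\<close>.\<close>

lemma surj_A: "surj ((*v) A)"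
proof -
  define g where "g i = (if i = 1 then \<lambda>x. (A *v x) $ 1 else if i = 2 then \<lambda>x. (A *v x) $ 2
      else if i = 3 then \<lambda>x. (A *v x) $ 3 else h)" for i :: 4
  have "linear_form (\<lambda>x. (A *v x) $ j)" for j
    by (simp add: linear_form_def vec.add vec.scale)
  then have "linear_form (g i)" for i
    using h by (auto simp: g_def)
  then obtain M where M: "\<And>x i. (M *v x) $ i = g i x"
    using matrix_of_linear_forms[of g] by blast
  have "x = 0" if "M *v x = 0" for x
  proof -
    have g0: "g i x = 0" for i
      using M[of x i] that by simp
    have "(A *v x) $ 1 = 0" "(A *v x) $ 2 = 0" "(A *v x) $ 3 = 0" "h x = 0"
      using g0[of 1] g0[of 2] g0[of 3] g0[of 4] by (auto simp: g_def)
    then have "A *v x = 0"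
      by (simp add: vec_eq_iff forall_3)
    then obtain r where "x = r *s p"
      using A_zero_iff by blast
    with \<open>h x = 0\<close> show ?thesis
      by (simp add: h_simps hp)
  qed
  then have "surj ((*v) M)"
    using invertible_if_trivial_kernel[of M]
    by (simp add: invertible_right_inverse matrix_right_invertible_surjective)
  have "\<exists>x. a = A *v x" for a
  proof -
    obtain x where x: "(\<chi> i. if i = 1 then a $ 1 else if i = 2 then a $ 2 else a $ 3) = M *v x"
      using surjD[OF \<open>surj ((*v) M)\<close>] by blast
    have g1: "g i x = (if i = 1 then a $ 1 else if i = 2 then a $ 2 else a $ 3)" for i
      using M[of x i] by (simp flip: x)
    have "a = A *v x"
      using g1[of 1] g1[of 2] g1[of 3] by (simp add: g_def vec_eq_iff forall_3)
    then show ?thesis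
      by blast
  qed
  then show ?thesis
    unfolding surj_def by blast
qed

text \<open>\<open>p\<close> and \<open>z0\<close> span a complement of the kernel \<open>C\<close>,
  so \<open>B\<close> is already bijective on their span.\<close>

lemma surj_B: "surj ((*v) B)"
proof -
  define M :: "complex ^ 2 ^ 2" where
    "M = (\<chi> i j. if j = 1 then (B *v p) $ i else (B *v z0) $ i)"
  have M: "M *v y = B *v (y $ 1 *s p + y $ 2 *s z0)" for y
    unfolding vec.add vec.scale
    by (simp add: M_def vec_eq_iff matrix_vector_mult_def[of "\<chi> i j. _ i j"] sum_2 mult.commute)
  have "y = 0" if "M *v y = 0" for y
  proof -
    have C0: "y $ 1 *s p + y $ 2 *s z0 \<in> C"
      using that unfolding M B_zero_iff .
    then have "y $ 2 = 0"
      by (simp add: C_eq u_simps up uz0)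
    with C0 have "y $ 1 = 0"
      by (simp add: C_eq h_simps hp)
    with \<open>y $ 2 = 0\<close> show ?thesis
      by (simp add: vec_eq_iff forall_2)
  qed
  then have "surj ((*v) M)"
    using invertible_if_trivial_kernel[of M]
    by (simp add: invertible_right_inverse matrix_right_invertible_surjective)
  then have "\<exists>x. b = B *v x" for b
    unfolding surj_def M by blast
  then show ?thesis
    unfolding surj_def by blast
qed

text \<open>The last conclusion keeps the image line out of the image plane: an inclusion would
  force the plane to be \<open>u = 0\<close>. The two values are \<open>u x\<close> and
  \<open>l x\<close> times the common factor \<open>u (T *v z0)\<close>, so they vanish together
  only on \<open>C\<close>.\<close>

lemma normal_form_projectivities:
  fixes T :: "complex ^ 4 ^ 4"
  assumes l: "linear_form l" "l p \<noteq> 0" "C = {x. l x = 0 \<and> u x = 0}"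
    and Q: "\<And>x. Q x = l x *s (T *v x) + (u x)\<^sup>2 *s c" and Tp: "T *v p = 0" and c0: "c \<noteq> 0"
    and inj: "\<And>z s. T *v z = s *s c \<Longrightarrow> \<exists>r. z = r *s p"
    and TC: "(*v) T ` C = C" and cp: "c = k *s p"
    and dom: "nondegenerate Q"
    and A': "A ** A' = mat 1" and B': "B ** B' = mat 1"
  obtains X Y where "invertible X" "invertible Y"
    "\<And>x. A *v Q x = l x *s (X *v (A *v x))" "\<And>x. B *v Q x = u x *s (Y *v (B *v x))"
    "\<And>x. x \<notin> C \<Longrightarrow> u (A' *v (X *v (A *v x))) \<noteq> 0 \<or> u (B' *v (Y *v (B *v x))) \<noteq> 0"
proof -
  note ls = linear_form_simps[OF l(1)]
  have k0: "k \<noteq> 0"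
    using c0 cp by auto
  have AA': "A *v (A' *v a) = a" and BB': "B *v (B' *v b) = b" for a b
    using A' B' by (simp_all add: matrix_vector_mul_assoc)
  have A'A: "\<exists>r. A' *v (A *v x) = x + r *s p" for x
  proof -
    have "A *v (A' *v (A *v x) - x) = 0"
      by (simp add: vec.diff AA')
    then show ?thesis
      unfolding A_zero_iff by (auto simp: algebra_simps)
  qed
  have B'B: "B' *v (B *v x) - x \<in> C" for x
    using B_zero_iff[of "B' *v (B *v x) - x"] by (simp add: vec.diff BB')
  note uA = u_A_right_inverse[OF A'] and uB = u_B_right_inverse[OF B']
  have lB: "l (B' *v (B *v x)) = l x" for x
    using B'B[of x] by (simp add: l(3) ls)
  have Ac: "A *v c = 0"
    unfolding cp vec.scale Ap by simp
  have Cr: "r = 0" if "r *s p \<in> C" for r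
    using that by (simp add: C_eq h_simps hp)
  define b where "b = B *v (T *v z0)"
  \<comment> \<open>\<open>B ** T\<close> kills both \<open>p\<close> and \<open>C\<close>, hence
    factors through \<open>u\<close>.\<close>
  have BT: "B *v (T *v z) = u z *s b" for z
  proof -
    have "(B ** T) *v z = u z *s ((B ** T) *v z0)"
    proof (rule matrix_vanishing_on_C_p)
      show "(B ** T) *v p = 0"
        by (simp add: Tp flip: matrix_vector_mul_assoc)
      show "(B ** T) *v x = 0" if "x \<in> C" for x
        using that TC B_zero_iff by (auto simp flip: matrix_vector_mul_assoc)
    qed
    then show ?thesis
      by (simp add: b_def flip: matrix_vector_mul_assoc)
  qed
  define X where "X = A ** T ** A'"
  have X: "X *v (A *v x) = A *v (T *v x)" for x
    using A'A[of x] by (auto simp: X_def vec.add vec.scale Tp simp flip: matrix_vector_mul_assoc)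
  have "linear_form (\<lambda>y. l (B' *v y) * b $ i + u (B' *v y) * (B *v c) $ i)" for i
    unfolding linear_form_def by (simp add: vec.add vec.scale ls u_simps algebra_simps)
  then obtain Y where Y': "\<And>y i. (Y *v y) $ i = l (B' *v y) * b $ i + u (B' *v y) * (B *v c) $ i"
    using matrix_of_linear_forms[of "\<lambda>i y. l (B' *v y) * b $ i + u (B' *v y) * (B *v c) $ i"] by blast
  have Y: "Y *v (B *v x) = l x *s b + u x *s (B *v c)" for x
    by (simp add: vec_eq_iff Y' lB uB)
  have invX: "invertible X"
  proof (rule invertible_if_trivial_kernel)
    fix a assume "X *v a = 0"
    then have "A *v (T *v (A' *v a)) = 0"
      using X[of "A' *v a"] AA' by simp
    then obtain s where "T *v (A' *v a) = s *s p"
      using A_zero_iff by blast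
    then have "T *v (A' *v a) = (s / k) *s c"
      using k0 by (simp add: cp vector_smult_assoc)
    then obtain r where "A' *v a = r *s p"
      using inj by blast
    then have "A *v (A' *v a) = 0"
      by (simp add: vec.scale Ap)
    then show "a = 0"
      by (simp add: AA')
  qed
  have invY: "invertible Y"
  proof (rule invertible_if_trivial_kernel)
    fix y assume y: "Y *v y = 0"
    define z where "z = B' *v y"
    have yz: "y = B *v z"
      by (simp add: z_def BB')
    have "B *v (l z *s (T *v z0) + u z *s c) = 0"
      using y Y[of z] by (simp add: yz vec.add vec.scale b_def)
    \<comment> \<open>Because \<open>C\<close> is its own image under \<open>T\<close>, this vector
      is some \<open>T *v w\<close>, and \<open>inj\<close> applies to \<open>l z *s z0 - w\<close>;
      applying \<open>u\<close> then gives \<open>l z = 0\<close>.\<close>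
    then have "l z *s (T *v z0) + u z *s c \<in> (*v) T ` C"
      unfolding B_zero_iff TC .
    then obtain w where w: "w \<in> C" "l z *s (T *v z0) + u z *s c = T *v w"
      by blast
    have "T *v (l z *s z0 - w) = (- u z) *s c"
      by (simp add: vec.diff vec.scale vector_smult_lneg flip: w(2))
    then obtain r where r: "l z *s z0 - w = r *s p"
      using inj by blast
    have "u (l z *s z0 - w) = 0"
      by (simp add: r u_simps up)
    then have lz: "l z = 0"
      using w(1) by (simp add: u_simps uz0 C_eq)
    then have "T *v w = u z *s c"
      using w(2) by simp
    then obtain r' where "w = r' *s p"
      using inj by blast
    then have "w = 0"
      using w(1) Cr by auto
    then have "u z = 0"
      using \<open>T *v w = u z *s c\<close> c0 by simp
    then show "y = 0"
      using lz l(3) unfolding yz B_zero_iff by simp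
  qed
  have "linear_form (\<lambda>x. u (T *v x))"
    using linear_form_matrix[OF u] .
  then have uT: "u (T *v z) = u (T *v z0) * u z" for z
    by (rule linear_form_vanishing_on_C_p) (use TC C_eq in \<open>auto simp: Tp u_simps\<close>)
  \<comment> \<open>Otherwise \<open>u\<close> would vanish on the whole image of \<open>Q\<close>,
    since it also kills \<open>c\<close>.\<close>
  have a0: "u (T *v z0) \<noteq> 0"
  proof
    assume "u (T *v z0) = 0"
    then have "u (Q x) = 0" for x
      using uT[of x] by (simp add: Q u_simps cp up)
    then have "u z0 = 0"
      by (rule nondegenerateD[OF dom u])
    with uz0 show False by simp
  qed
  show ?thesis
  proof (rule that[OF invX invY])
    show "A *v Q x = l x *s (X *v (A *v x))" for x
      by (simp add: Q vec.add vec.scale X Ac)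
    show "B *v Q x = u x *s (Y *v (B *v x))" for x
      by (simp add: Q vec.add vec.scale Y BT vector_smult_assoc vector_add_ldistrib
          power2_eq_square mult.commute)
    fix x assume "x \<notin> C"
    have "u (A' *v (X *v (A *v x))) = u (T *v z0) * u x"
      unfolding X uA by (rule uT)
    moreover have "u (B' *v (Y *v (B *v x))) = l x * u (T *v z0)"
      unfolding Y b_def by (simp add: vec.add vec.scale u_simps uB cp up)
    ultimately show "u (A' *v (X *v (A *v x))) \<noteq> 0 \<or> u (B' *v (Y *v (B *v x))) \<noteq> 0"
      using a0 \<open>x \<notin> C\<close> l(3) by auto
  qed
qed

end

section \<open>Holomorphic lifts of flows of projectivities\<close>

lemma matrix_mult_axis_component:
  fixes M :: "complex ^ 'n ^ 'm"
  shows "(M *v axis j 1) $ i = M $ i $ j"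
  by (simp add: matrix_vector_mult_def axis_def if_distrib cong: if_cong)

lemma same_projectivity_iff:
  fixes M N :: "complex ^ 'n ^ 'n"
  shows "same_projectivity M N \<longleftrightarrow> (\<exists>c. c \<noteq> 0 \<and> (\<forall>x. M *v x = c *s (N *v x)))"
  unfolding same_projectivity_def
proof (intro ex_cong1 conj_cong refl iffI allI)
  fix c x assume c: "\<forall>i j. M $ i $ j = c * N $ i $ j"
  show "M *v x = c *s (N *v x)"
    by (simp add: vec_eq_iff matrix_vector_mult_def c sum_distrib_left mult.assoc)
next
  fix c i j assume c: "\<forall>x. M *v x = c *s (N *v x)"
  show "M $ i $ j = c * N $ i $ j"
    using c[rule_format, of "axis j 1"] by (simp add: vec_eq_iff matrix_mult_axis_component)
qed

lemma same_projectivity_sym: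
  assumes "same_projectivity M N"
  shows "same_projectivity N M"
proof -
  obtain c where "c \<noteq> 0" "\<forall>i j. M $ i $ j = c * N $ i $ j"
    using assms unfolding same_projectivity_def by blast
  then show ?thesis
    unfolding same_projectivity_def by (intro exI[of _ "1 / c"]) simp
qed

lemma same_projectivity_trans:
  assumes "same_projectivity L M" "same_projectivity M N"
  shows "same_projectivity L N"
proof -
  obtain c d where "c \<noteq> 0" "\<forall>x. L *v x = c *s (M *v x)" "d \<noteq> 0" "\<forall>x. M *v x = d *s (N *v x)"
    using assms unfolding same_projectivity_iff by blast
  then show ?thesis
    unfolding same_projectivity_iff by (intro exI[of _ "c * d"]) (simp add: vector_smult_assoc)
qed

lemma same_projectivity_mult:
  assumes "same_projectivity M M'" "same_projectivity N N'"
  shows "same_projectivity (M ** N) (M' ** N')"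
proof -
  obtain c d where "c \<noteq> 0" "\<forall>x. M *v x = c *s (M' *v x)" "d \<noteq> 0" "\<forall>x. N *v x = d *s (N' *v x)"
    using assms unfolding same_projectivity_iff by blast
  then show ?thesis
    unfolding same_projectivity_iff
    by (intro exI[of _ "c * d"]) (simp add: vector_smult_assoc vec.scale flip: matrix_vector_mul_assoc)
qed

lemma invertible_ker: "invertible X \<Longrightarrow> X *v x = 0 \<Longrightarrow> x = 0" for X :: "complex ^ 'n ^ 'n"
  using matrix_left_invertible_ker[of X] by (simp add: invertible_left_inverse)

lemma invertible_same_projectivity:
  assumes "same_projectivity M N" "invertible N"
  shows "invertible M"
proof (rule invertible_if_trivial_kernel)
  fix x assume x: "M *v x = 0"
  obtain c where "c \<noteq> 0" "M *v x = c *s (N *v x)"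
    using assms(1) unfolding same_projectivity_iff by blast
  then have "N *v x = 0"
    using x by simp
  then show "x = 0"
    using invertible_ker[OF assms(2)] by blast
qed

text \<open>A matrix fixing every line is scalar: testing \<open>Y' ** X\<close> on basis vectors
  makes it diagonal, and on sums of two of them makes the diagonal constant.\<close>

lemma projectivity_determined_by_points:
  fixes X Y :: "complex ^ 'n ^ 'n"
  assumes "invertible X" "invertible Y" "\<And>a. par (X *v a) (Y *v a)"
  shows "same_projectivity X Y"
proof -
  obtain Y' where Y': "Y ** Y' = mat 1" "Y' ** Y = mat 1"
    using assms(2) unfolding invertible_def by blast
  define Z where "Z = Y' ** X"
  have par: "par (Z *v a) a" for a
    using par_matrix[OF assms(3)[of a], of Y'] by (simp add: Z_def matrix_vector_mul_assoc Y')
  have off: "Z $ i $ j = 0" if "i \<noteq> j" for i j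
    using par[of "axis j 1", unfolded par_def, rule_format, of i j] that
    unfolding matrix_mult_axis_component by (simp add: axis_def)
  have diag: "Z $ i $ i = Z $ j $ j" for i j
  proof (cases "i = j")
    case False
    then show ?thesis
      using par[of "axis i 1 + axis j 1", unfolded par_def, rule_format, of i j] off[of i j] off[of j i]
      unfolding vec.add vector_add_component matrix_mult_axis_component by (simp add: axis_def)
  qed simp
  define k :: 'n where "k = undefined"
  have "Z *v a = (Z $ k $ k) *s a" for a
  proof -
    have "(\<Sum>j\<in>UNIV. Z $ i $ j * a $ j) = (\<Sum>j\<in>UNIV. if j = i then Z $ k $ k * a $ i else 0)" for i
      by (rule sum.cong) (use off diag[of _ k] in auto)
    then show ?thesis
      by (simp add: vec_eq_iff matrix_vector_mult_def)
  qed
  then have XY: "X *v a = (Z $ k $ k) *s (Y *v a)" for a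
    using Y'(1) by (metis Z_def matrix_vector_mul_assoc matrix_vector_mul_lid vec.scale)
  moreover have "Z $ k $ k \<noteq> 0"
  proof
    assume "Z $ k $ k = 0"
    then have "X *v axis k 1 = 0"
      using XY by simp
    then have "axis k 1 = (0 :: complex ^ 'n)"
      using invertible_ker[OF assms(1)] by blast
    then show False
      by simp
  qed
  ultimately show ?thesis
    unfolding same_projectivity_iff by blast
qed

text \<open>The matrix, up to a factor, of the projectivity taking the standard frame to the points
  \<open>f j\<close> and \<open>f0\<close>, written polynomially in these vectors with the help of Cramer's rule.\<close>

definition frame_matrix :: "('n \<Rightarrow> complex ^ 'n) \<Rightarrow> complex ^ 'n \<Rightarrow> complex ^ 'n ^ 'n" where
  "frame_matrix f f0 = (\<chi> i j. det (\<chi> a b. if b = j then f0 $ a else f b $ a) * f j $ i)"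

text \<open>By Cramer's rule the determinant for column \<open>j\<close> is
  \<open>\<mu>0 / \<mu> j\<close> times that of the matrix of the points, and the factor
  \<open>\<mu> j\<close> of \<open>f j\<close> cancels the denominator. The unknown scalings thus
  leave a single overall factor.\<close>

lemma frame_matrix_same_projectivity:
  fixes N :: "complex ^ 'n ^ 'n"
  assumes "invertible N" and f: "\<And>j. f j = \<mu> j *s (N *v axis j 1)" "\<And>j. \<mu> j \<noteq> 0"
    and f0: "f0 = \<mu>0 *s (N *v 1)" "\<mu>0 \<noteq> 0"
  shows "same_projectivity (frame_matrix f f0) N"
proof -
  define E where "E = (\<chi> a b. f b $ a)"
  define y where "y = (\<chi> j. \<mu>0 / \<mu> j)"
  have E: "E $ a $ b = \<mu> b * N $ a $ b" for a b
    by (simp add: E_def f matrix_mult_axis_component)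
  have Ex: "E *v x = N *v (\<chi> b. \<mu> b * x $ b)" for x
    by (simp add: vec_eq_iff matrix_vector_mult_def E mult.assoc mult.left_commute)
  have "x = 0" if "E *v x = 0" for x
  proof -
    have "(\<chi> b. \<mu> b * x $ b) = 0"
      using that invertible_ker[OF assms(1)] unfolding Ex by blast
    then show ?thesis
      using f(2) by (simp add: vec_eq_iff)
  qed
  then have "det E \<noteq> 0"
    using invertible_if_trivial_kernel invertible_det_nz by blast
  moreover have "E *v y = f0"
  proof -
    have "(\<chi> b. \<mu> b * y $ b) = \<mu>0 *s 1"
      using f(2) by (simp add: y_def vec_eq_iff)
    then show ?thesis
      by (simp add: Ex f0 vec.scale)
  qed
  then have "det (\<chi> a b. if b = j then f0 $ a else f b $ a) = y $ j * det E" for j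
    using cramer_lemma[of j E y] by (simp add: E_def cong: if_cong)
  then have "frame_matrix f f0 $ i $ j = (\<mu>0 * det E) * N $ i $ j" for i j
    using f(2) by (simp add: frame_matrix_def y_def f matrix_mult_axis_component)
  ultimately show ?thesis
    unfolding same_projectivity_def using f0(2) by (intro exI[of _ "\<mu>0 * det E"]) simp
qed

section \<open>Holomorphic dependence on the parameter\<close>

lemma holomorphic_det:
  fixes M :: "complex \<Rightarrow> complex ^ 'n ^ 'n"
  assumes "\<And>i j. (\<lambda>t. M t $ i $ j) holomorphic_on S"
  shows "(\<lambda>t. det (M t)) holomorphic_on S"
  unfolding det_def by (intro holomorphic_intros assms)

lemma holomorphic_frame_matrix:
  assumes "\<And>i j. (\<lambda>t. f t j $ i) holomorphic_on S" "\<And>i. (\<lambda>t. f0 t $ i) holomorphic_on S"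
  shows "(\<lambda>t. frame_matrix (f t) (f0 t) $ i $ j) holomorphic_on S"
proof -
  have "(\<lambda>t. det (\<chi> a b. if b = j then f0 t $ a else f t b $ a)) holomorphic_on S"
  proof (rule holomorphic_det)
    show "(\<lambda>t. (\<chi> a b. if b = j then f0 t $ a else f t b $ a) $ a $ b) holomorphic_on S" for a b
      using assms by (cases "b = j") auto
  qed
  then show ?thesis
    using assms by (simp add: frame_matrix_def holomorphic_on_mult)
qed

lemma holomorphic_forms_evaluation:
  assumes "holomorphic_forms d U F"
  shows "(\<lambda>t. F t x $ i) holomorphic_on U"
proof -
  obtain c where c: "\<And>i \<alpha>. (\<lambda>t. c t i \<alpha>) holomorphic_on U"
    "\<And>t x i. t \<in> U \<Longrightarrow> F t x $ i = form_of d (c t i) x"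
    using assms unfolding holomorphic_forms_def by blast
  have "(\<lambda>t. form_of d (c t i) x) holomorphic_on U"
    unfolding form_of_def by (intro holomorphic_intros c)
  then show ?thesis
    using c(2) by (simp cong: holomorphic_cong)
qed

lemma holomorphic_forms_forms:
  assumes "holomorphic_forms d U F" "t \<in> U"
  shows "forms d (F t)"
proof -
  obtain c where "\<forall>x i. F t x $ i = form_of d (c i) x"
    using assms unfolding holomorphic_forms_def by blast
  then show ?thesis
    unfolding forms_def form_def by (metis ext)
qed

text \<open>The points are taken near a single point where \<open>F\<close> does not vanish; their sum is then close
  to a multiple of that point.\<close>

lemma frame_avoiding_zeros:
  fixes K :: "complex ^ 4 ^ 'n"
  assumes K: "surj ((*v) K)" and F: "forms d F" and q: "F q \<noteq> 0"
  obtains p :: "'n \<Rightarrow> complex ^ 4" where "\<And>i. F (p i) \<noteq> 0" "F (\<Sum>i\<in>UNIV. p i) \<noteq> 0"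
    "invertible (\<chi> a b. (K *v p b) $ a)"
proof -
  obtain k where k: "F q $ k \<noteq> 0"
    using q by (auto simp: vec_eq_iff)
  have "\<exists>x. K *v x = axis i 1" for i
    using K by (metis surjD)
  then obtain w where w: "\<And>i. K *v w i = axis i 1"
    by metis
  define n :: complex where "n = of_nat CARD('n)"
  have n: "F (n *s q) $ k \<noteq> 0"
    using k by (simp add: forms_homogeneous[OF F] n_def)
  \<comment> \<open>The matrix to be inverted is \<open>e\<close> times the identity plus the rank
    one matrix with all columns \<open>K *v q\<close>, whose trace is \<open>\<sigma>\<close>; it is
    singular only for \<open>e = 0\<close> or \<open>e = - \<sigma>\<close>.\<close>
  define \<sigma> where "\<sigma> = (\<Sum>j\<in>UNIV. (K *v q) $ j)"
  have "\<forall>\<^sub>F e in at 0. (\<forall>i\<in>UNIV. F (q + e *s w i) $ k \<noteq> 0) \<and>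
      F (n *s q + e *s (\<Sum>i\<in>UNIV. w i)) $ k \<noteq> 0 \<and> e \<noteq> 0 \<and> e \<noteq> - \<sigma>"
    by (intro eventually_conj eventually_ball_finite ballI eventually_neq_at_within
        polyfun_eventually_nonzero_on_line[OF polyfun_forms[OF F]] k n) simp
  then obtain e where e: "\<And>i. F (q + e *s w i) $ k \<noteq> 0"
    "F (n *s q + e *s (\<Sum>i\<in>UNIV. w i)) $ k \<noteq> 0" "e \<noteq> 0" "e \<noteq> - \<sigma>"
    using eventually_happens'[of "at (0 :: complex)"] by auto
  show ?thesis
  proof
    show "F (q + e *s w i) \<noteq> 0" for i
      using e(1)[of i] by auto
    have "(\<Sum>i\<in>UNIV. q + e *s w i) = n *s q + e *s (\<Sum>i\<in>UNIV. w i)"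
      unfolding vec_eq_iff sum_component by (simp add: sum.distrib n_def sum_distrib_left)
    then show "F (\<Sum>i\<in>UNIV. q + e *s w i) \<noteq> 0"
      using e(2) by auto
    show "invertible (\<chi> a b. (K *v (q + e *s w b)) $ a)"
    proof (rule invertible_if_trivial_kernel)
      fix y assume y: "(\<chi> a b. (K *v (q + e *s w b)) $ a) *v y = 0"
      define s where "s = (\<Sum>b\<in>UNIV. y $ b)"
      have comp: "s * (K *v q) $ a + e * y $ a = 0" for a
      proof -
        have "0 = ((\<chi> a b. (K *v (q + e *s w b)) $ a) *v y) $ a"
          using y by simp
        also have "\<dots> = (\<Sum>b\<in>UNIV. (K *v q) $ a * y $ b + (if b = a then e * y $ b else 0))"
          unfolding matrix_vector_mult_def[of "\<chi> i j. _ i j"] vec_lambda_beta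
          by (rule sum.cong) (auto simp: vec.add vec.scale w axis_def algebra_simps)
        also have "\<dots> = s * (K *v q) $ a + e * y $ a"
          by (simp add: sum.distrib s_def sum_distrib_right mult.commute)
        finally show ?thesis by simp
      qed
      have "s * (\<sigma> + e) = (\<Sum>a\<in>UNIV. s * (K *v q) $ a + e * y $ a)"
        by (simp add: sum.distrib \<sigma>_def s_def sum_distrib_left algebra_simps)
      then have "s * (\<sigma> + e) = 0"
        by (simp add: comp)
      then have "s = 0"
        using e(4) by (simp add: add_eq_0_iff)
      then show "y = 0"
        using comp e(3) by (simp add: vec_eq_iff)
    qed
  qed
qed

section \<open>Projectivities induced by birational maps\<close>

lemma surjective_image_nonzero:
  fixes K :: "complex ^ 4 ^ 'n"
  assumes K: "surj ((*v) K)" and F: "birational F"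
  obtains x i where "(K *v F x) $ i \<noteq> 0"
proof (rule ccontr)
  assume no: "\<not> thesis"
  define i :: 'n where "i = undefined"
  have "linear_form (\<lambda>x. (K *v x) $ i)"
    by (simp add: linear_form_def vec.add vec.scale)
  moreover have "(K *v F x) $ i = 0" for x
    using no that by blast
  ultimately have zero: "(K *v x) $ i = 0" for x
    using nondegenerateD[OF birational_nondegenerate[OF F], of "\<lambda>x. (K *v x) $ i"] by blast
  obtain x where "axis i 1 = K *v x"
    using K by (metis surjD)
  then have "axis i (1 :: complex) $ i = 0"
    by (simp add: zero)
  then show False
    by simp
qed

text \<open>Carries the relation from the quadratic normal form to \<open>\<phi> t\<close>, from
  there to the holomorphic lift, and finally to a representative that does not vanish at the point
  considered.\<close>

lemma par_image_transfer:
  fixes K :: "complex ^ 4 ^ 'n"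
  assumes F: "\<And>i. polyfun (\<lambda>x. F x $ i)" and G: "\<And>i. polyfun (\<lambda>x. G x $ i)"
    and FG: "same_map F G" and F_par: "\<And>x. par (K *v F x) (X *v (K *v x))"
  shows "par (K *v G x) (X *v (K *v x))"
proof -
  obtain y k where k: "F y $ k \<noteq> 0"
    using FG unfolding same_map_def by (auto simp: vec_eq_iff)
  have pX: "polyfun (\<lambda>x. (X *v (K *v x)) $ i)" for i
    by (intro polyfun_matrix polyfun.coord)
  show ?thesis
  proof (rule par_generic[OF polyfun_matrix[OF G] pX F k])
    fix x assume "F x $ k \<noteq> 0"
    then have "F x \<noteq> 0"
      by auto
    then obtain s where "G x = s *s F x"
      using parE[OF par_sym[OF same_map_par[OF FG]]] by blast
    then show "par (K *v G x) (X *v (K *v x))"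
      using F_par[of x] by (simp add: vec.scale par_def)
  qed
qed

lemma projectivity_composition:
  fixes K :: "complex ^ 4 ^ 'n"
  assumes K: "surj ((*v) K)" and bir: "birational F" "birational G" "birational H"
    and FGH: "same_map H (F \<circ> G)"
    and X: "invertible X" "\<And>x. par (K *v F x) (X *v (K *v x))"
    and Y: "invertible Y" "\<And>x. par (K *v G x) (Y *v (K *v x))"
    and Z: "invertible Z" "\<And>x. par (K *v H x) (Z *v (K *v x))"
  shows "same_projectivity Z (X ** Y)"
proof (rule projectivity_determined_by_points)
  show "invertible (X ** Y)"
    using X(1) Y(1) by (rule invertible_mult)
  note poly = birational_polyfun[OF bir(1)] birational_polyfun[OF bir(2)] birational_polyfun[OF bir(3)]
  obtain x1 i1 where nz1: "(K *v H x1) $ i1 \<noteq> 0"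
    using surjective_image_nonzero[OF K bir(3)] .
  obtain x2 i2 where nz2: "(K *v G x2) $ i2 \<noteq> 0"
    using surjective_image_nonzero[OF K bir(2)] .
  obtain x3 i3 where nz3: "F (G x3) $ i3 \<noteq> 0"
    using FGH unfolding same_map_def by (auto simp: vec_eq_iff)
  \<comment> \<open>Off the zeros of \<open>g\<close> every intermediate vector in the chain of
    proportionalities is nonzero, so transitivity applies.\<close>
  define g where "g x = (K *v H x) $ i1 * ((K *v G x) $ i2 * F (G x) $ i3)" for x
  have g1: "polyfun (\<lambda>x. (K *v H x) $ i1)" and g2: "polyfun (\<lambda>x. (K *v G x) $ i2)"
    and g3: "polyfun (\<lambda>x. F (G x) $ i3)"
    using polyfun_matrix[OF poly(3)] polyfun_matrix[OF poly(2)] polyfun_compose[OF poly(1,2)] by blast+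
  obtain x4 where nz4: "(K *v G x4) $ i2 * F (G x4) $ i3 \<noteq> 0"
    using polyfun_mult_nonzero[OF g2 g3 nz2 nz3] by auto
  obtain x5 where nz5: "g x5 \<noteq> 0"
    using polyfun_mult_nonzero[OF g1 polyfun.mult[OF g2 g3] nz1 nz4] by (auto simp: g_def)
  have pg: "polyfun g"
    unfolding g_def by (intro polyfun.mult g1 g2 g3)
  have pX: "polyfun (\<lambda>x. (M *v (K *v x)) $ i)" for i and M :: "complex ^ 'n ^ 'n"
    by (intro polyfun_matrix polyfun.coord)
  have main: "par (Z *v (K *v x)) ((X ** Y) *v (K *v x))" for x
  proof (rule par_generic[OF pX pX pg nz5])
    fix x assume "g x \<noteq> 0"
    then have nz: "K *v H x \<noteq> 0" "K *v G x \<noteq> 0" "F (G x) \<noteq> 0"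
      by (auto simp: g_def)
    have "par (H x) (F (G x))"
      using same_map_par[OF FGH, of x] by simp
    then obtain s where s: "H x = s *s F (G x)"
      using nz(3) by (rule parE)
    then have nzF: "K *v F (G x) \<noteq> 0"
      using nz(1) by (auto simp: vec.scale)
    have nzX: "X *v (K *v G x) \<noteq> 0"
      using nz(2) invertible_ker[OF X(1)] by blast
    have 1: "par (Z *v (K *v x)) (K *v H x)"
      by (rule par_sym[OF Z(2)])
    have 2: "par (K *v H x) (K *v F (G x))"
      by (simp add: s vec.scale par_scale_left)
    have 3: "par (K *v F (G x)) (X *v (K *v G x))"
      by (rule X(2))
    have 4: "par (X *v (K *v G x)) ((X ** Y) *v (K *v x))"
      using par_matrix[OF Y(2)[of x], of X] by (simp flip: matrix_vector_mul_assoc)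
    show "par (Z *v (K *v x)) ((X ** Y) *v (K *v x))"
      using par_trans[OF par_trans[OF par_trans[OF 1 2 nz(1)] 3 nzF] 4 nzX] .
  qed
  show "par (Z *v a) ((X ** Y) *v a)" for a
  proof -
    obtain x where "a = K *v x"
      using surjD[OF K] by blast
    then show ?thesis
      using main by simp
  qed
qed (fact Z(1))

lemma projectivity_of_identity:
  fixes K :: "complex ^ 4 ^ 'n"
  assumes K: "surj ((*v) K)" and bir: "birational F" and F: "same_map F id"
    and X: "invertible X" "\<And>x. par (K *v F x) (X *v (K *v x))"
  shows "same_projectivity X (mat 1)"
proof (rule projectivity_determined_by_points)
  have id: "polyfun (\<lambda>x. id x $ i)" for i
    by (simp add: polyfun.coord)
  show "par (X *v a) (mat 1 *v a)" for a
  proof -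
    obtain x where a: "a = K *v x"
      using surjD[OF K] by blast
    show ?thesis
      using par_sym[OF par_image_transfer[OF birational_polyfun[OF bir] id F X(2), of x]] by (simp add: a)
  qed
  show "invertible (mat 1 :: complex ^ 'n ^ 'n)"
    by (rule invertible_if_trivial_kernel) simp
qed (fact X(1))

text \<open>\<open>X\<close> carries no regularity in \<open>t\<close>. It is recovered up to
  scalars from the images of a fixed frame under \<open>F t\<close>, which are holomorphic whatever
  scalars relate them to \<open>X t\<close>.\<close>

lemma linear_flow_lift:
  fixes K :: "complex ^ 4 ^ 'n" and X :: "complex \<Rightarrow> complex ^ 'n ^ 'n"
  assumes K: "surj ((*v) K)" and r: "r > 0"
    and bir: "\<And>t. t \<in> ball 0 r \<Longrightarrow> birational (\<phi> t)"
    and hol: "holomorphic_forms d (ball 0 r) F"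
    and \<phi>F: "\<And>t. t \<in> ball 0 r \<Longrightarrow> same_map (\<phi> t) (F t)"
    and id: "same_map (\<phi> 0) id"
    and group: "\<And>s t. s \<in> ball 0 r \<Longrightarrow> t \<in> ball 0 r \<Longrightarrow> t + s \<in> ball 0 r \<Longrightarrow>
      same_map (\<phi> (t + s)) (\<phi> t \<circ> \<phi> s)"
    and inv: "\<And>t. t \<in> ball 0 r \<Longrightarrow> invertible (X t)"
    and X: "\<And>t x. t \<in> ball 0 r \<Longrightarrow> par (K *v \<phi> t x) (X t *v (K *v x))"
  obtains \<eta> where "linear_flow \<eta>" "\<forall>\<^sub>F t in nhds 0. same_projectivity (\<eta> t) (X t)"
proof -
  have 0: "0 \<in> ball 0 r"
    using r by simp
  have F: "forms d (F t)" if "t \<in> ball 0 r" for t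
    using holomorphic_forms_forms[OF hol that] .
  have parF: "par (K *v F t x) (X t *v (K *v x))" if t: "t \<in> ball 0 r" for t x
    using par_image_transfer[OF birational_polyfun[OF bir[OF t]] polyfun_forms[OF F[OF t]] \<phi>F[OF t] X[OF t]] .
  obtain y0 where y0: "\<phi> 0 y0 \<noteq> 0"
    using id unfolding same_map_def by auto
  \<comment> \<open>\<open>F 0\<close> may be the identity times a form of positive degree, so it
    can vanish at some points; the frame has to avoid these.\<close>
  have F0: "par (F 0 x) x" for x
  proof (rule par_trans_generic[OF polyfun_forms[OF F[OF 0]] birational_polyfun[OF bir[OF 0]] polyfun.coord])
    show "\<phi> 0 y0 \<noteq> 0" by (rule y0)
    show "par (F 0 x) (\<phi> 0 x)" for x
      by (rule par_sym[OF same_map_par[OF \<phi>F[OF 0]]])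
    show "par (\<phi> 0 x) x" for x
      using same_map_par[OF id, of x] by simp
  qed
  obtain q where q: "F 0 q \<noteq> 0"
    using \<phi>F[OF 0] unfolding same_map_def by blast
  obtain p :: "'n \<Rightarrow> complex ^ 4" where p: "\<And>i. F 0 (p i) \<noteq> 0" "F 0 (\<Sum>i\<in>UNIV. p i) \<noteq> 0"
    and N_inv: "invertible (\<chi> a b. (K *v p b) $ a)"
    using frame_avoiding_zeros[OF K F[OF 0] q] by blast
  define N where "N = (\<chi> a b. (K *v p b) $ a)"
  have N_axis: "N *v axis j 1 = K *v p j" for j
    unfolding vec_eq_iff matrix_mult_axis_component by (simp add: N_def)
  have N_one: "N *v 1 = K *v (\<Sum>i\<in>UNIV. p i)"
    unfolding vec.sum by (simp add: vec_eq_iff N_def matrix_vector_mult_def[of "\<chi> i j. _ i j"])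
  obtain N' where NN': "N ** N' = mat 1" "N' ** N = mat 1"
    using N_inv unfolding invertible_def N_def by blast
  define f where "f t j = K *v F t (p j)" for t j
  define f0 where "f0 t = K *v F t (\<Sum>i\<in>UNIV. p i)" for t
  \<comment> \<open>\<open>frame_matrix\<close> starts from the standard frame, while the images are
    those of the points \<open>K *v p j\<close>; \<open>N'\<close> makes up for this change of
    basis.\<close>
  define \<eta> where "\<eta> t = frame_matrix (f t) (f0 t) ** N'" for t
  have holK: "(\<lambda>t. (K *v F t x) $ i) holomorphic_on ball 0 r" for x i
    unfolding matrix_vector_mult_def vec_lambda_beta
    by (intro holomorphic_intros holomorphic_forms_evaluation[OF hol])
  have "(\<lambda>t. frame_matrix (f t) (f0 t) $ i $ j) holomorphic_on ball 0 r" for i j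
    by (rule holomorphic_frame_matrix) (simp_all add: f_def f0_def holK)
  then have hol\<eta>: "(\<lambda>t. \<eta> t $ i $ j) holomorphic_on ball 0 r" for i j
    unfolding \<eta>_def matrix_matrix_mult_def vec_lambda_beta by (intro holomorphic_intros)
  have near: "\<forall>\<^sub>F t in nhds 0. K *v F t x \<noteq> 0" if x: "F 0 x \<noteq> 0" "K *v x \<noteq> 0" for x
  proof -
    obtain s where s: "x = s *s F 0 x"
      by (rule parE[OF par_sym[OF F0] x(1)])
    then have "K *v F 0 x \<noteq> 0"
      using x(2) vec.scale[of K s "F 0 x"] by auto
    then obtain i where i: "(K *v F 0 x) $ i \<noteq> 0"
      by (auto simp: vec_eq_iff)
    have "isCont (\<lambda>t. (K *v F t x) $ i) 0"
      using holomorphic_on_imp_continuous_on[OF holK] 0 by (simp add: continuous_on_eq_continuous_at)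
    then have "\<forall>\<^sub>F t in at 0. (K *v F t x) $ i \<noteq> 0"
      unfolding isCont_def using i by (rule tendsto_imp_eventually_ne)
    then have "\<forall>\<^sub>F t in nhds 0. (K *v F t x) $ i \<noteq> 0"
      using i by (simp add: eventually_nhds_conv_at)
    then show ?thesis
      by (rule eventually_mono) auto
  qed
  have Kp: "K *v p j \<noteq> 0" for j
  proof
    assume "K *v p j = 0"
    then have "axis j 1 = (0 :: complex ^ 'n)"
      using invertible_ker[OF N_inv[folded N_def]] N_axis by metis
    then show False by simp
  qed
  have Kp0: "K *v (\<Sum>i\<in>UNIV. p i) \<noteq> 0"
  proof
    assume "K *v (\<Sum>i\<in>UNIV. p i) = 0"
    then have "1 = (0 :: complex ^ 'n)"
      using invertible_ker[OF N_inv[folded N_def]] N_one by metis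
    then show False by simp
  qed
  \<comment> \<open>Near 0 the frame points keep nonzero images, which makes the scalars relating
    them to \<open>X t\<close> nonzero, as the frame matrix requires.\<close>
  have "\<forall>\<^sub>F t in nhds 0. (\<forall>j\<in>UNIV. f t j \<noteq> 0) \<and> f0 t \<noteq> 0 \<and> t \<in> ball 0 r"
    unfolding f_def f0_def
    by (intro eventually_conj eventually_ball_finite ballI near p Kp Kp0 eventually_nhds_in_open 0) simp_all
  then obtain r' where r': "r' > 0" and nz: "\<And>t. t \<in> ball 0 r' \<Longrightarrow> (\<forall>j. f t j \<noteq> 0) \<and> f0 t \<noteq> 0 \<and> t \<in> ball 0 r"
    unfolding eventually_nhds_metric by (auto simp: dist_commute)
  have \<eta>X: "same_projectivity (\<eta> t) (X t)" if t: "t \<in> ball 0 r'" for t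
  proof -
    have tr: "t \<in> ball 0 r"
      using nz[OF t] by blast
    have "\<exists>m. m \<noteq> 0 \<and> K *v F t x = m *s (X t *v (K *v x))" if "K *v F t x \<noteq> 0" "K *v x \<noteq> 0" for x
    proof -
      have "X t *v (K *v x) \<noteq> 0"
        using that(2) invertible_ker[OF inv[OF tr]] by blast
      then obtain m where m: "K *v F t x = m *s (X t *v (K *v x))"
        by (rule parE[OF parF[OF tr]])
      then have "m \<noteq> 0"
        using that(1) by auto
      with m show ?thesis by blast
    qed
    then have "\<forall>j. \<exists>m. m \<noteq> 0 \<and> f t j = m *s ((X t ** N) *v axis j 1)"
      and "\<exists>m. m \<noteq> 0 \<and> f0 t = m *s ((X t ** N) *v 1)"
      using nz[OF t] Kp Kp0
      by (simp_all add: f_def f0_def N_axis N_one flip: matrix_vector_mul_assoc)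
    then obtain \<mu> \<mu>0 where "\<And>j. f t j = \<mu> j *s ((X t ** N) *v axis j 1)" "\<And>j. \<mu> j \<noteq> 0"
      "f0 t = \<mu>0 *s ((X t ** N) *v 1)" "\<mu>0 \<noteq> 0"
      by metis
    then have "same_projectivity (frame_matrix (f t) (f0 t)) (X t ** N)"
      using frame_matrix_same_projectivity[OF invertible_mult[OF inv[OF tr] N_inv[folded N_def]]] by blast
    moreover have "same_projectivity N' N'"
      unfolding same_projectivity_def by (intro exI[of _ 1]) simp
    ultimately have "same_projectivity (\<eta> t) (X t ** N ** N')"
      unfolding \<eta>_def by (rule same_projectivity_mult)
    then show ?thesis
      by (simp add: NN' flip: matrix_mul_assoc)
  qed
  have "r' \<le> r"
  proof (rule ccontr)
    assume "\<not> r' \<le> r"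
    then have "complex_of_real r \<in> ball 0 r'"
      using r by simp
    from nz[OF this] r show False by simp
  qed
  have "linear_flow \<eta>"
    unfolding linear_flow_def
  proof (intro exI[of _ r'] conjI allI ballI impI r')
    show "(\<lambda>t. \<eta> t $ i $ j) holomorphic_on ball 0 r'" for i j
      by (rule holomorphic_on_subset[OF hol\<eta>]) (use \<open>r' \<le> r\<close> in auto)
    show "invertible (\<eta> t)" if t: "t \<in> ball 0 r'" for t
      using invertible_same_projectivity[OF \<eta>X[OF t]] inv nz[OF t] by blast
    show "same_projectivity (\<eta> 0) (mat 1)"
      using same_projectivity_trans[OF \<eta>X projectivity_of_identity[OF K bir[OF 0] id inv[OF 0] X[OF 0]]] r' by simp
    fix s t :: complex assume st: "s \<in> ball 0 r'" "t \<in> ball 0 r'" "t + s \<in> ball 0 r'"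
    then have st': "s \<in> ball 0 r" "t \<in> ball 0 r" "t + s \<in> ball 0 r"
      using nz by blast+
    have "same_projectivity (X (t + s)) (X t ** X s)"
      using projectivity_composition[OF K bir[OF st'(2)] bir[OF st'(1)] bir[OF st'(3)] group[OF st']
          inv[OF st'(2)] X[OF st'(2)] inv[OF st'(1)] X[OF st'(1)] inv[OF st'(3)] X[OF st'(3)]] .
    moreover have "same_projectivity (X t ** X s) (\<eta> t ** \<eta> s)"
      using same_projectivity_mult[OF same_projectivity_sym[OF \<eta>X[OF st(2)]]
          same_projectivity_sym[OF \<eta>X[OF st(1)]]] .
    ultimately show "same_projectivity (\<eta> (t + s)) (\<eta> t ** \<eta> s)"
      using same_projectivity_trans[OF same_projectivity_trans[OF \<eta>X[OF st(3)]]] by blast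
  qed
  moreover have "\<forall>\<^sub>F t in nhds 0. same_projectivity (\<eta> t) (X t)"
    unfolding eventually_nhds_metric using r' \<eta>X by (intro exI[of _ r']) (auto simp: dist_commute)
  ultimately show ?thesis
    using that by blast
qed

section \<open>The flow\<close>

text \<open>\<open>K\<close> maps the join onto the multiples of \<open>K *v p\<close>, and the
  scalar between \<open>M\<close> and \<open>X\<close> is absorbed in \<open>s\<close>. It serves
  with \<open>A\<close> for lines through the point and with \<open>B\<close> for planes through the
  line.\<close>

lemma in_proj_act_join_iff:
  assumes "\<And>y. y \<in> S \<Longrightarrow> K *v y = 0" and M: "same_projectivity M X"
  shows "x \<in> proj_act K M ({p} \<or>\<^sub>P S) \<longleftrightarrow> (\<exists>s. K *v x = s *s (X *v (K *v p)))"
proof -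
  obtain c where c: "c \<noteq> 0" "\<And>x. M *v x = c *s (X *v x)"
    using M unfolding same_projectivity_iff by blast
  have span0: "K *v y = 0" if "y \<in> vec.span S" for y
  proof -
    have "vec.subspace {y. K *v y = 0}"
      by (simp add: vec.subspace_def vec.add vec.scale)
    then have "vec.span S \<subseteq> {y. K *v y = 0}"
      using assms(1) by (intro vec.span_minimal) auto
    with that show ?thesis by blast
  qed
  show ?thesis
  proof
    assume "x \<in> proj_act K M ({p} \<or>\<^sub>P S)"
    then obtain y where y: "y \<in> vec.span (insert p S)" "K *v x = M *v (K *v y)"
      unfolding proj_act_def join_def by auto
    then obtain k where "y - k *s p \<in> vec.span S"
      using vec.span_breakdown_eq by blast
    then have "K *v (y - k *s p) = 0"
      by (rule span0)
    then have "K *v y = k *s (K *v p)"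
      by (simp add: vec.diff vec.scale)
    then have "K *v x = (k * c) *s (X *v (K *v p))"
      by (simp add: y(2) vec.scale c(2) vector_smult_assoc)
    then show "\<exists>s. K *v x = s *s (X *v (K *v p))" ..
  next
    assume "\<exists>s. K *v x = s *s (X *v (K *v p))"
    then obtain s where "K *v x = s *s (X *v (K *v p))" ..
    then have "K *v x = M *v (K *v ((s / c) *s p))"
      using c(1) by (simp add: vec.scale c(2) vector_smult_assoc)
    moreover have "(s / c) *s p \<in> vec.span ({p} \<union> S)"
      by (intro vec.span_scale vec.span_base) simp
    ultimately show "x \<in> proj_act K M ({p} \<or>\<^sub>P S)"
      unfolding proj_act_def join_def by blast
  qed
qed

text \<open>Multiplying all coordinates by \<open>x $ 1\<close> writes the identity in degree 2.
  This places \<open>t = 0\<close> in the linear case of the conclusion.\<close>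

lemma is_lin_if_identity:
  assumes "same_map F id"
  shows "is_lin F"
proof -
  define L :: "complex ^ 4 \<Rightarrow> complex ^ 4" where "L = (\<lambda>x. \<chi> i. x $ 1 * x $ i)"
  have "L \<in> lin"
    unfolding lin_def
  proof (intro CollectI exI conjI allI impI)
    show "L = (\<lambda>x. \<chi> i. x $ 1 * x $ i)" by (fact L_def)
    show "(\<lambda>x :: complex ^ 4. x $ 1) \<noteq> (\<lambda>_. 0)"
      by (metis axis_nth zero_neq_one)
    show "(\<lambda>x. x $ i) \<in> A1" for i
      by (rule coord_in_A1)
    fix a :: "4 \<Rightarrow> complex" and i
    assume "\<forall>x :: complex ^ 4. (\<Sum>i\<in>UNIV. a i * x $ i) = 0"
    from this[rule_format, of "axis i 1"] show "a i = 0"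
      by (simp add: axis_def if_distrib cong: if_cong)
  qed (rule coord_in_A1)
  moreover have "same_map F L"
    unfolding same_map_def
  proof (intro conjI allI)
    show "\<exists>x. F x \<noteq> 0"
      using assms by (simp add: same_map_def)
    have "L (axis 1 1) $ 1 \<noteq> 0"
      by (simp add: L_def)
    then show "\<exists>x. L x \<noteq> 0"
      by (metis zero_index)
    show "F x $ i * L x $ j = F x $ j * L x $ i" for x i j
      using assms by (simp add: same_map_def L_def mult.left_commute)
  qed
  ultimately show ?thesis
    unfolding is_lin_def by blast
qed

lemma representative_nondegenerate:
  assumes "birational F" "same_map F Q" "\<And>i. polyfun (\<lambda>x. Q x $ i)"
  shows "nondegenerate Q"
  unfolding nondegenerate_def
proof (intro allI impI)
  fix w x assume w: "linear_form w" "\<forall>x. w (Q x) = 0"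
  obtain y k where k: "Q y $ k \<noteq> 0"
    using assms(2) unfolding same_map_def by (auto simp: vec_eq_iff)
  have "w (F x) = 0" for x
  proof (rule polyfun_zero_if_generically_zero[where f = "\<lambda>x. w (F x)", OF _ assms(3) k])
    show "polyfun (\<lambda>x. w (F x))"
      by (rule polyfun_compose[OF polyfun_linear_form[OF w(1)] birational_polyfun[OF assms(1)]])
    fix x assume "Q x $ k \<noteq> 0"
    then have "Q x \<noteq> 0"
      by auto
    then obtain s where "F x = s *s Q x"
      by (rule parE[OF same_map_par[OF assms(2)]])
    then show "w (F x) = 0"
      by (simp add: linear_form_simps[OF w(1)] w(2))
  qed
  then show "w x = 0"
    by (rule nondegenerateD[OF birational_nondegenerate[OF assms(1)] w(1)])
qed

context point_and_line
begin

text \<open>\<open>generic22_normal_form\<close> brings its own equation of the plane through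
  \<open>p\<close> and \<open>C\<close>; it is a multiple of the fixed \<open>u\<close>, and the
  square of the factor goes into \<open>c\<close>.\<close>

lemma fixed_normal_form:
  assumes "generic22 F" "is_PI F p" "is_CI F l q" "double_line l q C"
  obtains Q and T :: "complex ^ 4 ^ 4" and c where
    "forms 2 Q" "same_map F Q" "linear_form l" "l p \<noteq> 0" "C = {x. l x = 0 \<and> u x = 0}"
    "T *v p = 0" "\<And>x. Q x = l x *s (T *v x) + (u x)\<^sup>2 *s c"
proof -
  obtain Q and T :: "complex ^ 4 ^ 4" and c u' where
    nf: "forms 2 Q" "same_map F Q" "l p \<noteq> 0"
      "linear_form l" "linear_form u'" "u' \<noteq> (\<lambda>_. 0)" "u' p = 0" "C = {x. l x = 0 \<and> u' x = 0}"
      "T *v p = 0" "\<And>x. Q x = l x *s (T *v x) + (u' x)\<^sup>2 *s c"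
    by (rule generic22_normal_form[OF assms]) (rule that)
  have u': "u' z = u' z0 * u z" for z
    by (rule linear_form_vanishing_on_C_p[OF nf(5,7)]) (use nf(8) in blast)
  have nz: "u' z0 \<noteq> 0"
  proof
    assume "u' z0 = 0"
    then have "u' z = 0" for z
      using u'[of z] by simp
    then show False
      using nf(6) by (simp add: fun_eq_iff)
  qed
  have u0: "u' x = 0 \<longleftrightarrow> u x = 0" for x
    using u'[of x] nz by simp
  show ?thesis
  proof (rule that[OF nf(1,2,4,3) _ nf(9)])
    show "C = {x. l x = 0 \<and> u x = 0}"
      unfolding nf(8) u0 ..
    show "Q x = l x *s (T *v x) + (u x)\<^sup>2 *s ((u' z0)\<^sup>2 *s c)" for x
      using u'[of x] nf(10)[of x] by (simp add: power_mult_distrib vector_smult_assoc mult.commute)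
  qed
qed

text \<open>Meant for \<open>G = \<phi> t\<close> and \<open>F = \<phi> (- t)\<close>, which share
  \<open>p\<close> and \<open>C\<close>.\<close>

lemma induced_projectivities:
  assumes G: "birational G" "generic22 G" "is_PI G p" "is_CI G l q" "double_line l q C"
    and F: "birational F" "generic22 F" "is_PI F p" "is_CI F l' q'" "double_line l' q' C"
    and FG: "\<And>x. par (F (G x)) x" "F (G y) \<noteq> 0"
    and A': "A ** A' = mat 1" and B': "B ** B' = mat 1"
  obtains X Y where "invertible X" "invertible Y"
    "\<And>x. par (A *v G x) (X *v (A *v x))" "\<And>x. par (B *v G x) (Y *v (B *v x))"
    "\<And>x. x \<notin> C \<Longrightarrow> u (A' *v (X *v (A *v x))) \<noteq> 0 \<or> u (B' *v (Y *v (B *v x))) \<noteq> 0"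
proof -
  obtain Q and T :: "complex ^ 4 ^ 4" and c where Q: "forms 2 Q" "same_map G Q"
    and l: "linear_form l" "l p \<noteq> 0" "C = {x. l x = 0 \<and> u x = 0}"
    and T: "T *v p = 0" "\<And>x. Q x = l x *s (T *v x) + (u x)\<^sup>2 *s c"
    by (rule fixed_normal_form[OF G(2-5)]) (rule that)
  obtain Q' and T' :: "complex ^ 4 ^ 4" and c' where Q': "forms 2 Q'" "same_map F Q'"
    and l': "linear_form l'" "l' p \<noteq> 0" "C = {x. l' x = 0 \<and> u x = 0}"
    and T': "T' *v p = 0" "\<And>x. Q' x = l' x *s (T' *v x) + (u x)\<^sup>2 *s c'"
    by (rule fixed_normal_form[OF F(2-5)]) (rule that)
  note dom = representative_nondegenerate[OF G(1) Q(2) polyfun_forms[OF Q(1)]]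
    and dom' = representative_nondegenerate[OF F(1) Q'(2) polyfun_forms[OF Q'(1)]]
  note nf = normal_form_injective[where Q = Q and l = l and T = T and u = u and c = c
      and p = p, OF T(2) dom l(1,2) T(1)]
    and nf' = normal_form_injective[where Q = Q' and l = l' and T = T' and u = u and c = c'
      and p = p, OF T'(2) dom' l'(1,2) T'(1)]
  have un: "u \<noteq> (\<lambda>_. 0)"
    using uz0 by auto
  obtain d where d: "forms d F"
    using birational_forms[OF F(1)] .
  obtain z where z: "Q z \<noteq> 0"
    using Q(2) unfolding same_map_def by blast
  have inv: "par (Q' (Q x)) x" for x
    by (rule par_inverse_representatives[OF d polyfun_forms[OF Q'(1)] birational_polyfun[OF G(1)]
          polyfun_forms[OF Q(1)] same_map_par[OF Q'(2)] same_map_par[OF Q(2)] FG(2) z FG(1)])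
  note base_rule = normal_form_preserves_base_locus[where Q = Q and Q' = Q' and l = l and T = T and u = u
      and c = c and p = p and l' = l' and u' = u and T' = T' and c' = c' and C = C]
  have inj: "\<And>z s. T *v z = s *s c \<Longrightarrow> \<exists>r. z = r *s p" and inj': "\<And>z s. T' *v z = s *s c' \<Longrightarrow> \<exists>r. z = r *s p"
    and c0: "c \<noteq> 0" and c0': "c' \<noteq> 0"
    using nf nf' by blast+
  have TC: "(*v) T ` C = C"
    by (rule base_rule(1)) (fact l u up un T c0 inj l' T' c0' inj' inv)+
  have "\<exists>k. c = k *s p"
    by (rule base_rule(2)) (fact l u up un T c0 inj l' T' c0' inj' inv)+
  then obtain k where k: "c = k *s p" ..
  have QG: "same_map Q G"
    using Q(2) unfolding same_map_def by (simp add: mult.commute)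
  note transfer = par_image_transfer[OF polyfun_forms[OF Q(1)] birational_polyfun[OF G(1)] QG]
  show ?thesis
  proof (rule normal_form_projectivities[where Q = Q and l = l and T = T and c = c and k = k
        and A' = A' and B' = B'])
    fix X Y
    assume XY: "invertible X" "invertible Y"
      "\<And>x. A *v Q x = l x *s (X *v (A *v x))" "\<And>x. B *v Q x = u x *s (Y *v (B *v x))"
      "\<And>x. x \<notin> C \<Longrightarrow> u (A' *v (X *v (A *v x))) \<noteq> 0 \<or> u (B' *v (Y *v (B *v x))) \<noteq> 0"
    show ?thesis
    proof (rule that[OF XY(1,2) _ _ XY(5)])
      show "par (A *v G x) (X *v (A *v x))" "par (B *v G x) (Y *v (B *v x))" for x
        by (rule transfer; simp add: XY(3,4) par_scale_left)+
    qed
  qed (fact l T inj c0 TC k dom A' B')+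
qed

lemma A_B_zero: "A *v x = 0 \<Longrightarrow> B *v x = 0 \<Longrightarrow> x = 0"
  unfolding A_zero_iff B_zero_iff by (auto simp: C_eq h_simps hp)

text \<open>A point on both the image line and the image plane satisfies one linear condition on its two
  coordinates, which is nontrivial unless the line lies in the plane.\<close>

lemma line_inter_plane:
  assumes A': "A ** A' = mat 1" and B': "B ** B' = mat 1"
    and nz: "u (A' *v a) \<noteq> 0 \<or> u (B' *v b) \<noteq> 0"
    and y: "y \<noteq> 0" "A *v y = s *s a" "B *v y = t *s b"
    and x: "A *v x = s' *s a" "B *v x = t' *s b"
  shows "\<exists>k. x = k *s y"
proof -
  note uA = u_A_right_inverse[OF A'] and uB = u_B_right_inverse[OF B']
  \<comment> \<open>\<open>u y\<close> is computed once through \<open>A\<close> and once through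
    \<open>B\<close>.\<close>
  have y_eq: "s * u (A' *v a) = t * u (B' *v b)"
    using uA[of y] uB[of y] by (simp add: y vec.scale u_simps)
  have x_eq: "s' * u (A' *v a) = t' * u (B' *v b)"
    using uA[of x] uB[of x] by (simp add: x vec.scale u_simps)
  have st: "s \<noteq> 0 \<or> t \<noteq> 0"
    using A_B_zero[of y] y by auto
  have cross: "s' * t = s * t'"
  proof (cases "u (B' *v b) = 0")
    case True
    then show ?thesis
      using x_eq y_eq nz by simp
  next
    case False
    have "s' * t * u (B' *v b) = s * t' * u (B' *v b)"
      unfolding mult.assoc x_eq[symmetric] y_eq[symmetric] by (rule mult.left_commute)
    with False show ?thesis by simp
  qed
  obtain k where k: "s' = k * s" "t' = k * t"
  proof (cases "s = 0")
    case True
    then show ?thesis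
      using that[of "t' / t"] st cross by simp
  next
    case False
    then show ?thesis
      using that[of "s' / s"] cross by (simp add: field_simps)
  qed
  have "x - k *s y = 0"
    by (rule A_B_zero) (simp_all add: vec.diff vec.scale x y k vector_smult_assoc)
  then show ?thesis
    by auto
qed

end

text \<open>\<open>A\<close> and \<open>B\<close> are arbitrary homogeneous coordinates on the net
  and on the pencil. The equality is restricted because at \<open>t = 0\<close>, for a point of the
  plane spanned by \<open>P\<^sub>I\<close> and \<open>C\<^sub>I\<close>, the line lies in the plane
  and the intersection is larger than a point.\<close>

theorem corollary3:
  fixes \<phi> :: "complex \<Rightarrow> complex ^ 4 \<Rightarrow> complex ^ 4"
    and P\<^sub>I :: "complex ^ 4" and C\<^sub>I :: "(complex ^ 4) set"
    and A :: "complex ^ 4 ^ 3" and B :: "complex ^ 4 ^ 2"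
  assumes "quadratic_generic_flow \<phi>"
    and "flow_PI \<phi> P\<^sub>I"
    and "flow_CI \<phi> C\<^sub>I"
    and "{x. A *v x = 0} = vec.span {P\<^sub>I}"
    and "{x. B *v x = 0} = C\<^sub>I"
  shows "\<exists>(\<eta> :: complex \<Rightarrow> complex ^ 3 ^ 3) (\<xi> :: complex \<Rightarrow> complex ^ 2 ^ 2).
           linear_flow \<eta> \<and> linear_flow \<xi> \<and>
           (\<forall>\<^sub>F t in nhds 0. \<forall>P Q.
              P \<notin> vec.span {P\<^sub>I} \<longrightarrow> P \<notin> C\<^sub>I \<longrightarrow> image_at (\<phi> t) P Q \<longrightarrow>
                (let L = proj_act A (\<eta> t) ({P} \<or>\<^sub>P {P\<^sub>I});
                     H = proj_act B (\<xi> t) ({P} \<or>\<^sub>P C\<^sub>I)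
                 in Q \<in> L \<inter> H \<and>
                    (\<not> is_lin (\<phi> t) \<or> P \<notin> {P\<^sub>I} \<or>\<^sub>P C\<^sub>I \<longrightarrow> vec.span {Q} = L \<inter> H)))"
proof -
  have germ: "flow_germ \<phi>" and nonlin: "\<forall>\<^sub>F t in at 0. \<not> is_lin (\<phi> t)"
    and gen22: "\<forall>\<^sub>F t in nhds 0. \<not> is_lin (\<phi> t) \<longrightarrow> generic22 (\<phi> t)"
    using assms(1) unfolding quadratic_generic_flow_def quadratic_flow_def by blast+
  obtain r0 d F where r0: "r0 > 0" and bir0: "\<And>t. t \<in> ball 0 r0 \<Longrightarrow> birational (\<phi> t)"
    and hol0: "holomorphic_forms d (ball 0 r0) F"
    and same0: "\<And>t. t \<in> ball 0 r0 \<Longrightarrow> same_map (\<phi> t) (F t)" and id: "same_map (\<phi> 0) id"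
    and group0: "\<And>s t. s \<in> ball 0 r0 \<Longrightarrow> t \<in> ball 0 r0 \<Longrightarrow> t + s \<in> ball 0 r0 \<Longrightarrow>
      same_map (\<phi> (t + s)) (\<phi> t \<circ> \<phi> s)"
    using germ unfolding flow_germ_def by blast
  define gen where "gen t l q \<longleftrightarrow> generic22 (\<phi> t) \<and> is_PI (\<phi> t) P\<^sub>I \<and> is_CI (\<phi> t) l q \<and> double_line l q C\<^sub>I"
    for t l q
  have "\<forall>\<^sub>F t in nhds 0. t \<noteq> 0 \<longrightarrow> \<not> is_lin (\<phi> t)"
    using nonlin by (simp add: eventually_at_filter)
  moreover have "\<forall>\<^sub>F t in nhds 0. t \<in> ball 0 r0"
    using r0 by (intro eventually_nhds_in_open) auto
  ultimately have "\<forall>\<^sub>F t in nhds 0. t \<in> ball 0 r0 \<and> (t \<noteq> 0 \<longrightarrow> (\<exists>l q. gen t l q))"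
    using gen22 assms(2)[unfolded flow_PI_def] assms(3)[unfolded flow_CI_def]
    by eventually_elim (auto simp: gen_def)
  then obtain r where r: "r > 0"
    and near: "\<forall>t. dist t 0 < r \<longrightarrow> t \<in> ball 0 r0 \<and> (t \<noteq> 0 \<longrightarrow> (\<exists>l q. gen t l q))"
    unfolding eventually_nhds_metric by blast
  have in_r0: "t \<in> ball 0 r0" and gen: "t \<noteq> 0 \<Longrightarrow> \<exists>l q. gen t l q" if "t \<in> ball 0 r" for t
    using near[rule_format, of t] that unfolding mem_ball dist_commute[of 0] by blast+
  note bir = bir0[OF in_r0] and same = same0[OF in_r0]
  have group: "same_map (\<phi> (t + s)) (\<phi> t \<circ> \<phi> s)"
    if "s \<in> ball 0 r" "t \<in> ball 0 r" "t + s \<in> ball 0 r" for s t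
    using group0 in_r0 that by blast
  have hol: "holomorphic_forms d (ball 0 r) F"
    using hol0 in_r0 holomorphic_on_subset[of _ "ball 0 r0" "ball 0 r"]
    unfolding holomorphic_forms_def by blast
  have zero: "0 \<in> ball 0 r"
    using r by simp
  have id_par: "par (\<phi> 0 x) x" for x
    using same_map_par[OF id, of x] by simp

  \<comment> \<open>Any nonzero parameter of the ball will do: its normal form serves to produce the
    fixed equations \<open>h\<close> and \<open>u\<close>.\<close>
  define t1 :: complex where "t1 = of_real (r / 2)"
  have t1: "t1 \<in> ball 0 r" "t1 \<noteq> 0"
    using r by (auto simp: t1_def)
  obtain l q where "gen t1 l q"
    using gen[OF t1] by blast
  then have gen_t1: "generic22 (\<phi> t1)" "is_PI (\<phi> t1) P\<^sub>I" "is_CI (\<phi> t1) l q" "double_line l q C\<^sub>I"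
    by (auto simp: gen_def)
  obtain u where lu: "l P\<^sub>I \<noteq> 0" "linear_form l" "linear_form u" "u \<noteq> (\<lambda>_. 0)" "u P\<^sub>I = 0"
    "C\<^sub>I = {x. l x = 0 \<and> u x = 0}"
    by (rule generic22_normal_form[OF gen_t1]) (rule that)
  obtain z where z: "u z \<noteq> 0"
    using lu(4) by auto
  define h where "h x = l x / l P\<^sub>I" for x
  have "linear_form h"
    using lu(1,2) by (auto simp: h_def linear_form_def add_divide_distrib)
  then interpret point_and_line P\<^sub>I C\<^sub>I h u "(1 / u z) *s z" A B
    using lu z assms(4,5) by unfold_locales (auto simp: h_def linear_form_simps(2)[OF lu(3)])
  obtain A' B' where A': "A ** A' = mat 1" and B': "B ** B' = mat 1"
    using surj_A surj_B matrix_right_invertible_surjective[of A] matrix_right_invertible_surjective[of B]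
    by blast

  \<comment> \<open>At \<open>t = 0\<close> both matrices can be the identity and the two values
    reduce to \<open>u x\<close>, so transversality is lost on the plane \<open>u = 0\<close>; hence
    the weakened last clause.\<close>
  define good where "good t X Y \<longleftrightarrow> invertible X \<and> invertible Y \<and>
      (\<forall>x. par (A *v \<phi> t x) (X *v (A *v x))) \<and> (\<forall>x. par (B *v \<phi> t x) (Y *v (B *v x))) \<and>
      (\<forall>x. x \<notin> C\<^sub>I \<longrightarrow> t \<noteq> 0 \<or> u x \<noteq> 0 \<longrightarrow>
        u (A' *v (X *v (A *v x))) \<noteq> 0 \<or> u (B' *v (Y *v (B *v x))) \<noteq> 0)" for t X Y
  have "\<exists>X Y. good t X Y" if t: "t \<in> ball 0 r" for t
  proof (cases "t = 0")
    case True
    have "invertible (mat 1 :: complex ^ 3 ^ 3)" "invertible (mat 1 :: complex ^ 2 ^ 2)"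
      by (rule invertible_if_trivial_kernel; simp)+
    then have "good t (mat 1) (mat 1)"
      unfolding good_def True
      by (simp add: par_matrix[OF id_par] u_A_right_inverse[OF A'])
    then show ?thesis by blast
  next
    case False
    have t': "- t \<in> ball 0 r" "- t \<noteq> 0"
      using t False by auto
    obtain l q l' q' where gens: "gen t l q" "gen (- t) l' q'"
      using gen[OF t False] gen[OF t'] by blast
    have inverse: "same_map (\<phi> 0) (\<phi> (- t) \<circ> \<phi> t)"
      using group[OF t t'(1)] zero by simp
    obtain y y' where y: "\<phi> (- t) (\<phi> t y) \<noteq> 0" and y': "\<phi> 0 y' \<noteq> 0"
      using inverse unfolding same_map_def by auto
    have inv_par: "par (\<phi> (- t) (\<phi> t x)) x" for x
    proof (rule par_trans_generic[OF _ birational_polyfun[OF bir[OF zero]] polyfun.coord _ id_par y'])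
      show "polyfun (\<lambda>x. \<phi> (- t) (\<phi> t x) $ i)" for i
        by (rule polyfun_compose[OF birational_polyfun birational_polyfun]) (rule bir t t')+
      show "par (\<phi> (- t) (\<phi> t x)) (\<phi> 0 x)" for x
        using par_sym[OF same_map_par[OF inverse, of x]] by simp
    qed
    show ?thesis
    proof (rule induced_projectivities[OF bir[OF t] _ _ _ _ bir[OF t'(1)] _ _ _ _ inv_par y A' B'])
      fix X Y
      assume "invertible X" "invertible Y"
        "\<And>x. par (A *v \<phi> t x) (X *v (A *v x))" "\<And>x. par (B *v \<phi> t x) (Y *v (B *v x))"
        "\<And>x. x \<notin> C\<^sub>I \<Longrightarrow> u (A' *v (X *v (A *v x))) \<noteq> 0 \<or> u (B' *v (Y *v (B *v x))) \<noteq> 0"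
      then show ?thesis
        unfolding good_def by blast
    qed (use gens in \<open>auto simp: gen_def\<close>)
  qed
  then obtain X Y where XY: "\<And>t. t \<in> ball 0 r \<Longrightarrow> good t (X t) (Y t)"
    by metis
  have X: "invertible (X t)" "par (A *v \<phi> t x) (X t *v (A *v x))"
    and Y: "invertible (Y t)" "par (B *v \<phi> t x) (Y t *v (B *v x))" if "t \<in> ball 0 r" for t x
    using XY[OF that] unfolding good_def by auto
  obtain \<eta> where \<eta>: "linear_flow \<eta>" "\<forall>\<^sub>F t in nhds 0. same_projectivity (\<eta> t) (X t)"
    using linear_flow_lift[OF surj_A r bir hol same id group X] by blast
  obtain \<xi> where \<xi>: "linear_flow \<xi>" "\<forall>\<^sub>F t in nhds 0. same_projectivity (\<xi> t) (Y t)"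
    using linear_flow_lift[OF surj_B r bir hol same id group Y] by blast

  have main: "Q \<in> L \<inter> H \<and> (\<not> is_lin (\<phi> t) \<or> P \<notin> {P\<^sub>I} \<or>\<^sub>P C\<^sub>I \<longrightarrow> vec.span {Q} = L \<inter> H)"
    if t: "t \<in> ball 0 r" and \<eta>X: "same_projectivity (\<eta> t) (X t)" and \<xi>Y: "same_projectivity (\<xi> t) (Y t)"
      and P: "P \<notin> vec.span {P\<^sub>I}" "P \<notin> C\<^sub>I" and im: "image_at (\<phi> t) P Q"
      and L: "L = proj_act A (\<eta> t) ({P} \<or>\<^sub>P {P\<^sub>I})" and H: "H = proj_act B (\<xi> t) ({P} \<or>\<^sub>P C\<^sub>I)"
    for t P Q L H
  proof -
    \<comment> \<open>\<open>\<phi> t\<close> may itself vanish at \<open>P\<close>;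
      \<open>image_at\<close> provides a representative that does not.\<close>
    obtain d' G where G: "forms d' G" "same_map (\<phi> t) G" "G P = Q" and Q0: "Q \<noteq> 0"
      using im unfolding image_at_def by blast
    note phi_poly = birational_polyfun[OF bir[OF t]]
    have AQ: "par (A *v Q) (X t *v (A *v P))" and BQ: "par (B *v Q) (Y t *v (B *v P))"
      using par_image_transfer[OF phi_poly polyfun_forms[OF G(1)] G(2) X(2)[OF t], of P]
        par_image_transfer[OF phi_poly polyfun_forms[OF G(1)] G(2) Y(2)[OF t], of P]
      by (simp_all add: G(3))
    have "X t *v (A *v P) \<noteq> 0"
    proof
      assume "X t *v (A *v P) = 0"
      then have "A *v P = 0"
        by (rule invertible_ker[OF X(1)[OF t]])
      with P(1) show False
        unfolding A_zero_iff in_span_singleton_iff by blast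
    qed
    then obtain s where s: "A *v Q = s *s (X t *v (A *v P))"
      by (rule parE[OF AQ])
    have "Y t *v (B *v P) \<noteq> 0"
    proof
      assume "Y t *v (B *v P) = 0"
      then have "B *v P = 0"
        by (rule invertible_ker[OF Y(1)[OF t]])
      with P(2) show False
        unfolding B_zero_iff by blast
    qed
    then obtain s' where s': "B *v Q = s' *s (Y t *v (B *v P))"
      by (rule parE[OF BQ])
    have in_L: "x \<in> L \<longleftrightarrow> (\<exists>k. A *v x = k *s (X t *v (A *v P)))" for x
      unfolding L by (rule in_proj_act_join_iff[OF _ \<eta>X]) (simp add: Ap)
    have in_H: "x \<in> H \<longleftrightarrow> (\<exists>k. B *v x = k *s (Y t *v (B *v P)))" for x
      unfolding H by (rule in_proj_act_join_iff[OF _ \<xi>Y]) (simp add: B_zero_iff)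
    have QLH: "Q \<in> L \<inter> H"
      using in_L in_H s s' by blast
    moreover have "vec.span {Q} = L \<inter> H" if nd: "\<not> is_lin (\<phi> t) \<or> P \<notin> {P\<^sub>I} \<or>\<^sub>P C\<^sub>I"
    proof (intro equalityI subsetI)
      fix x assume "x \<in> vec.span {Q}"
      then obtain k where "x = k *s Q"
        unfolding in_span_singleton_iff by blast
      then have "A *v x = (k * s) *s (X t *v (A *v P))" "B *v x = (k * s') *s (Y t *v (B *v P))"
        by (simp_all add: vec.scale s s' vector_smult_assoc)
      then show "x \<in> L \<inter> H"
        using in_L in_H by blast
    next
      fix x assume "x \<in> L \<inter> H"
      then obtain k k' where "A *v x = k *s (X t *v (A *v P))" "B *v x = k' *s (Y t *v (B *v P))"
        using in_L in_H by blast
      \<comment> \<open>Failure means \<open>t = 0\<close> with \<open>P\<close> in the plane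
        \<open>u = 0\<close>: a linear map at a point of the span of \<open>P\<^sub>I\<close> and
        \<open>C\<^sub>I\<close>, against \<open>nd\<close>.\<close>
      moreover have "t \<noteq> 0 \<or> u P \<noteq> 0"
      proof (rule ccontr)
        assume "\<not> (t \<noteq> 0 \<or> u P \<noteq> 0)"
        then have t0: "t = 0" and uP: "u P = 0"
          by auto
        have "P - h P *s P\<^sub>I \<in> C\<^sub>I"
          by (simp add: C_eq h_simps u_simps hp up uP)
        then have "P - h P *s P\<^sub>I \<in> vec.span ({P\<^sub>I} \<union> C\<^sub>I)"
          by (intro vec.span_base) simp
        moreover have "h P *s P\<^sub>I \<in> vec.span ({P\<^sub>I} \<union> C\<^sub>I)"
          by (intro vec.span_scale vec.span_base) simp
        ultimately have "(P - h P *s P\<^sub>I) + h P *s P\<^sub>I \<in> {P\<^sub>I} \<or>\<^sub>P C\<^sub>I"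
          unfolding join_def by (rule vec.span_add)
        moreover have "is_lin (\<phi> t)"
          unfolding t0 by (rule is_lin_if_identity[OF id])
        ultimately show False
          using nd by simp
      qed
      then have "u (A' *v (X t *v (A *v P))) \<noteq> 0 \<or> u (B' *v (Y t *v (B *v P))) \<noteq> 0"
        using XY[OF t] P(2) unfolding good_def by blast
      ultimately show "x \<in> vec.span {Q}"
        using line_inter_plane[OF A' B' _ Q0 s s'] unfolding in_span_singleton_iff by blast
    qed
    ultimately show ?thesis
      by blast
  qed
  have "\<forall>\<^sub>F t in nhds 0. t \<in> ball 0 r"
    using zero by (intro eventually_nhds_in_open) auto
  then have "\<forall>\<^sub>F t in nhds 0. \<forall>P Q. P \<notin> vec.span {P\<^sub>I} \<longrightarrow> P \<notin> C\<^sub>I \<longrightarrow> image_at (\<phi> t) P Q \<longrightarrow>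
      (let L = proj_act A (\<eta> t) ({P} \<or>\<^sub>P {P\<^sub>I}); H = proj_act B (\<xi> t) ({P} \<or>\<^sub>P C\<^sub>I)
       in Q \<in> L \<inter> H \<and> (\<not> is_lin (\<phi> t) \<or> P \<notin> {P\<^sub>I} \<or>\<^sub>P C\<^sub>I \<longrightarrow> vec.span {Q} = L \<inter> H))"
    using \<eta>(2) \<xi>(2)
  proof eventually_elim
    case (elim t)
    show ?case
      unfolding Let_def by (intro allI impI main[OF elim]) (assumption | rule refl)+
  qed
  with \<eta>(1) \<xi>(1) show ?thesis
    by blast
qed

end
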